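(* Let $M$ be a smooth Banach manifold. Then: (i) The complete lift of a spray is a spray; that is, if $S$ is a spray on $T^iM$ ($i\ge0$), then $S^c$ is a spray on $T^{i+1}M$. (ii) If $S$ is a spray on $M$, then $S^{c_\infty}=\varprojlim S^{c_i}$ is a spray on $T^\infty M$.
   Context: All maps and manifolds are smooth; $M$ is a Banach manifold modeled on a Banach space $\mathbb{E}$ and admits smooth partitions of unity ("partitionable"). $T^0M=M$, $T^rM=T(T^{r-1}M)$, and $\pi_r:T^{r+1}M\to T^rM$ is the tangent bundle projection. $D$ denotes the tangent map, $D^2=DD$. Atlas: for an atlas $\{(U_\alpha,\phi_\alpha)\}_{\alpha\in I}$ of $M$, put $\phi_{\alpha_0}=\phi_\alpha$, $U_{\alpha_0}=U_\alpha$, $U_{\alpha_r}=\pi_{r-1}^{-1}(U_{\alpha_{r-1}})$, $\phi_{\alpha_r}=D\phi_{\alpha_{r-1}}$; these are charts of $T^rM$ with model space $\mathbb{E}_r=\mathbb{E}^{2^r}$. We identify $U_{\alpha_r}$ with its image in $\mathbb{E}_r$, so that $U_{\alpha_{r+1}}$ is identified with $U_{\alpha_r}\times\mathbb{E}_r$. Canonical involution: $\kappa_1=\mathrm{id}_{TM}$, and for $r\ge 2$, $\kappa_r:T^rM\to T^rM$ is the diffeomorphism with $\partial_t\partial_s\gamma(t,s)=\kappa_r\partial_s\partial_t\gamma(t,s)$ for every smooth $\gamma:(-\epsilon,\epsilon)^2\to T^{r-2}M$; in charts $\kappa_r(x,y,X,Y)=(x,X,y,Y)$. Complete lift: for a vector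 field $\mathbf{A}:T^rM\to T^{r+1}M$ ($r\ge0$), $\mathbf{A}^c=D\kappa_{r+1}\circ\kappa_{r+2}\circ D\mathbf{A}\circ\kappa_{r+1}:T^{r+1}M\to T^{r+2}M$, a vector field on $T^{r+1}M$. For a vector field $S$ on $TM$: $S^{c_0}=S$, $S^{c_j}=(S^{c_{j-1}})^c:T(T^jM)\to T^2(T^jM)$. Semisprays and sprays: a semispray on $T^iM$ is a vector field $S:T^{i+1}M\to T^{i+2}M$ with $\kappa_{i+2}\circ S=S$ (equivalently $D\pi_i\circ S=\mathrm{id}$). In the charts above it has the form $(x,y)\mapsto(x,y;y,-2G_\alpha(x,y))$ with smooth $G_\alpha:U_{\alpha_i}\times\mathbb{E}_i\to\mathbb{E}_i$. It is called a (2-homogeneous) spray if $G_\alpha(x,\lambda y)=\lambda^2G_\alpha(x,y)$ for all $\alpha\in I$, $\lambda\in\mathbb{R}$, $(x,y)\in U_{\alpha_i}\times\mathbb{E}_i$. A semispray on $T^\infty M$ is a vector field $S$ on $TT^\infty M$ with $D\pi_{T^\infty M}\circ S=\mathrm{id}$, where $\pi_{T^\infty M}=\varprojlim\pi_i:TT^\infty M\to T^\infty M$ is the tangent projection; it is a spray if its local components $G_\alpha^\infty:U_{\alpha_\infty}\times\mathbb{E}_\infty\to\mathbb{E}_\infty$ in the limit charts (defined in the same way) satisfy $G_\alpha^\infty(x,\lambda y)=\lambda^2G_\alpha^\infty(x,y)$ for all $\lambda\in\mathbb{R}$. $T^\infty M$: the projective limit $\varprojlim T^iM$ of the system $\{T^iM\}_{i\in\mathbb{N}}$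 with connecting maps $\pi_i:T^{i+1}M\to T^iM$. It is a (generalized) Fréchet manifold modeled on $\mathbb{E}_\infty=\varprojlim\mathbb{E}_i$ (connecting maps $\mathbb{E}_{i+1}=\mathbb{E}_i^2\to\mathbb{E}_i$, $(x,y)\mapsto x$), with charts $(U_{\alpha_\infty}=\varprojlim U_{\alpha_i},\ \varprojlim\phi_{\alpha_i})$. Its tangent bundles are identified with projective limits: $TT^\infty M=\varprojlim\{T(T^iM),D\pi_i\}$ and $T^2(T^\infty M)=\varprojlim\{T^2(T^iM),D^2\pi_i\}$, with the corresponding limit charts; $S^{c_\infty}=\varprojlim S^{c_i}$ maps $(\xi_i)_i$ to $(S^{c_i}(\xi_i))_i$. *)

theory Defs
  imports "HOL-Analysis.Analysis" "HOL-Library.Function_Algebras"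
begin

section \<open>Model spaces\<close>

text \<open>
  Functions form a real vector space under the pointwise operations of
  Function_Algebras; their topology is the product topology of HOL-Analysis.
\<close>

instantiation "fun" :: (type, real_vector) real_vector
begin

definition scaleR_fun :: "real \<Rightarrow> ('a \<Rightarrow> 'b) \<Rightarrow> 'a \<Rightarrow> 'b" where
  "scaleR_fun r f = (\<lambda>x. r *\<^sub>R f x)"

instance
  by standard (auto simp: scaleR_fun_def plus_fun_def fun_eq_iff scaleR_add_right scaleR_add_left)

end

text \<open>
  All the model spaces \<open>E_r = E^(2^r)\<close> are realised inside the single type \<open>nat \<Rightarrow> 'a\<close>, since a
  type cannot depend on \<open>r\<close>. Pairs of such functions are again such functions, by interleaving:
  \<open>vpair\<close> is a linear homeomorphism of the square of \<open>nat \<Rightarrow> 'a\<close> onto \<open>nat \<Rightarrow> 'a\<close>, with inverse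
  \<open>(vfst, vsnd)\<close>. \<open>E_0\<close> is \<open>'a\<close>, placed in coordinate 0, and \<open>E_(r+1)\<close> is \<open>E_r \<times> E_r\<close>.
  On \<open>model r\<close> only the coordinates below \<open>2^r\<close> can be nonzero, so for a Banach space \<open>'a\<close> the
  product topology restricts to the norm topology of \<open>E^(2^r)\<close>.
\<close>

definition vpair :: "(nat \<Rightarrow> 'a) \<Rightarrow> (nat \<Rightarrow> 'a) \<Rightarrow> nat \<Rightarrow> 'a" where
  "vpair x y = (\<lambda>j. if even j then x (j div 2) else y (j div 2))"

definition vfst :: "(nat \<Rightarrow> 'a) \<Rightarrow> nat \<Rightarrow> 'a" where
  "vfst c = (\<lambda>j. c (2 * j))"

definition vsnd :: "(nat \<Rightarrow> 'a) \<Rightarrow> nat \<Rightarrow> 'a" where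
  "vsnd c = (\<lambda>j. c (2 * j + 1))"

definition base :: "'a::zero \<Rightarrow> nat \<Rightarrow> 'a" where
  "base x = (\<lambda>j. if j = 0 then x else 0)"

text \<open>\<open>Tset X U\<close> is \<open>U \<times> X\<close>, the tangent bundle of an open subset \<open>U\<close> of the vector space \<open>X\<close>.\<close>

definition Tset :: "(nat \<Rightarrow> 'a) set \<Rightarrow> (nat \<Rightarrow> 'a) set \<Rightarrow> (nat \<Rightarrow> 'a) set" where
  "Tset X U = {vpair x v | x v. x \<in> U \<and> v \<in> X}"

primrec model :: "nat \<Rightarrow> (nat \<Rightarrow> 'a::zero) set" where
  "model 0 = range base"
| "model (Suc r) = Tset (model r) (model r)"


section \<open>Smooth maps\<close>

definition has_dir_deriv ::
    "('a::real_vector \<Rightarrow> 'b::{real_vector,topological_space}) \<Rightarrow> 'a \<Rightarrow> 'a \<Rightarrow> 'b \<Rightarrow> bool" where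
  "has_dir_deriv f x v d \<longleftrightarrow> ((\<lambda>t::real. (f (x + t *\<^sub>R v) - f x) /\<^sub>R t) \<longlongrightarrow> d) (at 0)"

definition dir_deriv ::
    "('a::real_vector \<Rightarrow> 'b::{real_vector,topological_space}) \<Rightarrow> 'a \<Rightarrow> 'a \<Rightarrow> 'b" where
  "dir_deriv f x v = (THE d. has_dir_deriv f x v d)"

text \<open>The local tangent map \<open>(x, v) \<mapsto> (f x, df x v)\<close>.\<close>

definition Tmap ::
    "((nat \<Rightarrow> 'a::real_vector) \<Rightarrow> (nat \<Rightarrow> 'b::{real_vector,topological_space}))
      \<Rightarrow> (nat \<Rightarrow> 'a) \<Rightarrow> (nat \<Rightarrow> 'b)" where
  "Tmap f c = vpair (f (vfst c)) (dir_deriv f (vfst c) (vsnd c))"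

text \<open>
  Differentiability of class \<open>C^k\<close> on a relatively open subset \<open>U\<close> of a vector subspace \<open>X\<close>, in the
  sense of Michal and Bastiani: \<open>f\<close> is \<open>C^(k+1)\<close> if all directional derivatives exist and the
  tangent map \<open>Tf\<close> on \<open>U \<times> X\<close> is \<open>C^k\<close> (in particular continuous). This is the usual calculus of
  Frechet spaces (Hamilton, Milnor); between Banach spaces its \<open>C^\<infinity>\<close> maps are exactly the
  infinitely Frechet differentiable ones.
\<close>

primrec C_diff ::
    "nat \<Rightarrow> (nat \<Rightarrow> 'a::{real_vector,topological_space}) set \<Rightarrow> (nat \<Rightarrow> 'a) set
      \<Rightarrow> ((nat \<Rightarrow> 'a) \<Rightarrow> (nat \<Rightarrow> 'b::{real_vector,topological_space})) \<Rightarrow> bool" where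
  "C_diff 0 X U f \<longleftrightarrow> continuous_on U f"
| "C_diff (Suc k) X U f \<longleftrightarrow>
     (\<forall>x\<in>U. \<forall>v\<in>X. \<exists>d. has_dir_deriv f x v d) \<and> C_diff k (Tset X X) (Tset X U) (Tmap f)"

definition smooth ::
    "(nat \<Rightarrow> 'a::{real_vector,topological_space}) set \<Rightarrow> (nat \<Rightarrow> 'a) set
      \<Rightarrow> ((nat \<Rightarrow> 'a) \<Rightarrow> (nat \<Rightarrow> 'b::{real_vector,topological_space})) \<Rightarrow> bool" where
  "smooth X U f \<longleftrightarrow> (\<forall>k. C_diff k X U f)"


section \<open>Banach manifolds\<close>

record ('m, 'i, 'e) atlas =
  Pts :: "'m set"
  Idx :: "'i set"
  Dom :: "'i \<Rightarrow> 'm set"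
  Cht :: "'i \<Rightarrow> 'm \<Rightarrow> 'e"

text \<open>The chart image of \<open>Dom M \<alpha> \<inter> Dom M \<beta>\<close> under \<open>\<alpha>\<close>, and the coordinate change, at level \<open>r\<close>.\<close>

primrec overlap :: "('m, 'i, 'e::zero) atlas \<Rightarrow> nat \<Rightarrow> 'i \<Rightarrow> 'i \<Rightarrow> (nat \<Rightarrow> 'e) set" where
  "overlap M 0 \<alpha> \<beta> = base ` (Cht M \<alpha> ` (Dom M \<alpha> \<inter> Dom M \<beta>))"
| "overlap M (Suc r) \<alpha> \<beta> = Tset (model r) (overlap M r \<alpha> \<beta>)"

text \<open>The point of \<open>M\<close> with coordinate vector \<open>c \<in> model 0\<close> in the chart \<open>\<alpha>\<close>.\<close>

definition Upt :: "('m, 'i, 'e) atlas \<Rightarrow> 'i \<Rightarrow> (nat \<Rightarrow> 'e) \<Rightarrow> 'm" where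
  "Upt M \<alpha> c = inv_into (Dom M \<alpha>) (Cht M \<alpha>) (c 0)"

primrec trans_map ::
    "('m, 'i, 'e::real_normed_vector) atlas \<Rightarrow> nat \<Rightarrow> 'i \<Rightarrow> 'i \<Rightarrow> (nat \<Rightarrow> 'e) \<Rightarrow> (nat \<Rightarrow> 'e)" where
  "trans_map M 0 \<alpha> \<beta> = (\<lambda>c. base (Cht M \<beta> (Upt M \<alpha> c)))"
| "trans_map M (Suc r) \<alpha> \<beta> = Tmap (trans_map M r \<alpha> \<beta>)"

definition banach_manifold :: "('m, 'i, 'e::banach) atlas \<Rightarrow> bool" where
  "banach_manifold M \<longleftrightarrow>
     (\<Union>\<alpha>\<in>Idx M. Dom M \<alpha>) = Pts M \<and>
     (\<forall>\<alpha>\<in>Idx M. inj_on (Cht M \<alpha>) (Dom M \<alpha>)) \<and>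
     (\<forall>\<alpha>\<in>Idx M. \<forall>\<beta>\<in>Idx M. open (Cht M \<alpha> ` (Dom M \<alpha> \<inter> Dom M \<beta>)) \<and>
        smooth (model 0) (overlap M 0 \<alpha> \<beta>) (trans_map M 0 \<alpha> \<beta>))"

definition mopen :: "('m, 'i, 'e::banach) atlas \<Rightarrow> 'm set \<Rightarrow> bool" where
  "mopen M W \<longleftrightarrow> W \<subseteq> Pts M \<and> (\<forall>\<alpha>\<in>Idx M. open (Cht M \<alpha> ` (W \<inter> Dom M \<alpha>)))"

definition smooth_fun :: "('m, 'i, 'e::banach) atlas \<Rightarrow> ('m \<Rightarrow> real) \<Rightarrow> bool" where
  "smooth_fun M h \<longleftrightarrow>
     (\<forall>\<alpha>\<in>Idx M. smooth (model 0) (overlap M 0 \<alpha> \<alpha>) (\<lambda>c. base (h (Upt M \<alpha> c))))"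

definition partition_of_unity ::
    "('m, 'i, 'e::banach) atlas \<Rightarrow> 'm set set \<Rightarrow> ('m set \<Rightarrow> 'm \<Rightarrow> real) \<Rightarrow> bool" where
  "partition_of_unity M \<W> \<rho> \<longleftrightarrow>
     (\<forall>W\<in>\<W>. smooth_fun M (\<rho> W) \<and> (\<forall>p\<in>Pts M. 0 \<le> \<rho> W p) \<and>
        \<comment> \<open>the support of \<open>\<rho> W\<close> is contained in \<open>W\<close>\<close>
        (\<forall>p\<in>Pts M - W. \<exists>N. mopen M N \<and> p \<in> N \<and> (\<forall>q\<in>N. \<rho> W q = 0))) \<and>
     (\<forall>p\<in>Pts M. \<exists>N. mopen M N \<and> p \<in> N \<and> finite {W\<in>\<W>. \<exists>q\<in>N. \<rho> W q \<noteq> 0}) \<and>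
     (\<forall>p\<in>Pts M. (\<Sum>W\<in>{W\<in>\<W>. \<rho> W p \<noteq> 0}. \<rho> W p) = 1)"

definition partitionable :: "('m, 'i, 'e::banach) atlas \<Rightarrow> bool" where
  "partitionable M \<longleftrightarrow>
     (\<forall>\<W>. (\<forall>W\<in>\<W>. mopen M W) \<and> \<Union>\<W> = Pts M \<longrightarrow> (\<exists>\<rho>. partition_of_unity M \<W> \<rho>))"


section \<open>Higher order tangent bundles\<close>

text \<open>
  \<open>T^r M\<close> is glued from the sets \<open>overlap M r \<alpha> \<alpha>\<close> (the chart images of \<open>U_(\<alpha>_r)\<close>) along the
  \<open>r\<close>-fold tangent maps of the coordinate changes. A point is the equivalence class of its
  coordinates, i.e. the set of all pairs \<open>(\<beta>, \<phi>_(\<beta>_r) \<xi>)\<close> with \<open>\<xi>\<close> in the domain of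
  \<open>\<phi>_(\<beta>_r)\<close>. For \<open>r = 0\<close> this is \<open>M\<close> itself, with \<open>p\<close> identified with its set of coordinates.
\<close>

type_synonym ('i, 'e) tpoint = "('i \<times> (nat \<Rightarrow> 'e)) set"

definition tpt ::
    "('m, 'i, 'e::banach) atlas \<Rightarrow> nat \<Rightarrow> 'i \<Rightarrow> (nat \<Rightarrow> 'e) \<Rightarrow> ('i, 'e) tpoint" where
  "tpt M r \<alpha> c = {(\<beta>, trans_map M r \<alpha> \<beta> c) | \<beta>. \<beta> \<in> Idx M \<and> c \<in> overlap M r \<alpha> \<beta>}"

definition TM :: "('m, 'i, 'e::banach) atlas \<Rightarrow> nat \<Rightarrow> ('i, 'e) tpoint set" where
  "TM M r = {tpt M r \<alpha> c | \<alpha> c. \<alpha> \<in> Idx M \<and> c \<in> overlap M r \<alpha> \<alpha>}"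

definition coord :: "('i, 'e) tpoint \<Rightarrow> 'i \<Rightarrow> nat \<Rightarrow> 'e" where
  "coord \<xi> \<alpha> = (THE c. (\<alpha>, c) \<in> \<xi>)"

text \<open>The projection \<open>\<pi>_r\<close>; the formula does not depend on \<open>r\<close>.\<close>

definition proj :: "('i, 'e) tpoint \<Rightarrow> ('i, 'e) tpoint" where
  "proj \<xi> = {(\<alpha>, vfst c) | \<alpha> c. (\<alpha>, c) \<in> \<xi>}"

definition loc_rep ::
    "('m, 'i, 'e::banach) atlas \<Rightarrow> nat \<Rightarrow> (('i, 'e) tpoint \<Rightarrow> ('i, 'e) tpoint)
      \<Rightarrow> 'i \<Rightarrow> 'i \<Rightarrow> (nat \<Rightarrow> 'e) \<Rightarrow> (nat \<Rightarrow> 'e)" where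
  "loc_rep M r f \<alpha> \<beta> c = coord (f (tpt M r \<alpha> c)) \<beta>"

text \<open>
  The tangent map \<open>T(T^r M) \<rightarrow> T(T^s M)\<close> of a map \<open>f\<close> from \<open>T^r M\<close> to \<open>T^s M\<close>: each coordinate
  vector of \<open>\<xi>\<close> is mapped by the tangent maps of the local representatives of \<open>f\<close>, for all charts
  \<open>\<beta>\<close> around the image of the base point.
\<close>

definition Dmap ::
    "('m, 'i, 'e::banach) atlas \<Rightarrow> nat \<Rightarrow> (('i, 'e) tpoint \<Rightarrow> ('i, 'e) tpoint)
      \<Rightarrow> ('i, 'e) tpoint \<Rightarrow> ('i, 'e) tpoint" where
  "Dmap M r f \<xi> = {(\<beta>, Tmap (loc_rep M r f \<alpha> \<beta>) c) | \<alpha> \<beta> c.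
     (\<alpha>, c) \<in> \<xi> \<and> (\<exists>b. (\<beta>, b) \<in> f (proj \<xi>))}"

text \<open>In every chart, \<open>kappa r\<close> is \<open>((x, y), (X, Y)) \<mapsto> ((x, X), (y, Y))\<close> for \<open>r \<ge> 2\<close>.\<close>

definition swap_mid :: "(nat \<Rightarrow> 'e) \<Rightarrow> (nat \<Rightarrow> 'e)" where
  "swap_mid c = vpair (vpair (vfst (vfst c)) (vfst (vsnd c))) (vpair (vsnd (vfst c)) (vsnd (vsnd c)))"

definition kappa :: "nat \<Rightarrow> ('i, 'e) tpoint \<Rightarrow> ('i, 'e) tpoint" where
  "kappa r \<xi> = (if r < 2 then \<xi> else {(\<alpha>, swap_mid c) | \<alpha> c. (\<alpha>, c) \<in> \<xi>})"


section \<open>Vector fields, complete lifts and sprays\<close>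

text \<open>
  A vector field on \<open>T^r M\<close> is a section of \<open>\<pi>_r\<close>, hence maps the domain of each chart of \<open>T^r M\<close>
  to the domain of the corresponding chart of \<open>T^(r+1) M\<close>; smoothness is smoothness in these charts.
  Values outside \<open>TM M r\<close> are irrelevant.
\<close>

definition vector_field ::
    "('m, 'i, 'e::banach) atlas \<Rightarrow> nat \<Rightarrow> (('i, 'e) tpoint \<Rightarrow> ('i, 'e) tpoint) \<Rightarrow> bool" where
  "vector_field M r S \<longleftrightarrow>
     (\<forall>\<xi>\<in>TM M r. S \<xi> \<in> TM M (Suc r) \<and> proj (S \<xi>) = \<xi>) \<and>
     (\<forall>\<alpha>\<in>Idx M. smooth (model r) (overlap M r \<alpha> \<alpha>) (loc_rep M r S \<alpha> \<alpha>))"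

text \<open>The complete lift of a vector field on \<open>T^r M\<close>.\<close>

definition clift ::
    "('m, 'i, 'e::banach) atlas \<Rightarrow> nat \<Rightarrow> (('i, 'e) tpoint \<Rightarrow> ('i, 'e) tpoint)
      \<Rightarrow> ('i, 'e) tpoint \<Rightarrow> ('i, 'e) tpoint" where
  "clift M r S = Dmap M (Suc r) (kappa (Suc r)) \<circ> kappa (Suc (Suc r)) \<circ> Dmap M r S \<circ> kappa (Suc r)"

text \<open>The iterated lifts \<open>S^(c_j)\<close> of a vector field \<open>S\<close> on \<open>TM\<close>; \<open>S^(c_j)\<close> lives on \<open>T^(j+1) M\<close>.\<close>

primrec clift_iter ::
    "('m, 'i, 'e::banach) atlas \<Rightarrow> (('i, 'e) tpoint \<Rightarrow> ('i, 'e) tpoint)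
      \<Rightarrow> nat \<Rightarrow> ('i, 'e) tpoint \<Rightarrow> ('i, 'e) tpoint" where
  "clift_iter M S 0 = S"
| "clift_iter M S (Suc j) = clift M (Suc j) (clift_iter M S j)"

definition semispray ::
    "('m, 'i, 'e::banach) atlas \<Rightarrow> nat \<Rightarrow> (('i, 'e) tpoint \<Rightarrow> ('i, 'e) tpoint) \<Rightarrow> bool" where
  "semispray M i S \<longleftrightarrow>
     vector_field M (Suc i) S \<and> (\<forall>\<xi>\<in>TM M (Suc i). kappa (i + 2) (S \<xi>) = S \<xi>)"

text \<open>\<open>G_\<alpha>\<close>, read off from the local form \<open>((x, y), (y, - 2 G_\<alpha>(x, y)))\<close> of a semispray.\<close>

definition spray_coeff ::
    "('m, 'i, 'e::banach) atlas \<Rightarrow> nat \<Rightarrow> (('i, 'e) tpoint \<Rightarrow> ('i, 'e) tpoint)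
      \<Rightarrow> 'i \<Rightarrow> (nat \<Rightarrow> 'e) \<Rightarrow> (nat \<Rightarrow> 'e) \<Rightarrow> (nat \<Rightarrow> 'e)" where
  "spray_coeff M i S \<alpha> x y = (- 1 / 2) *\<^sub>R vsnd (vsnd (loc_rep M (Suc i) S \<alpha> \<alpha> (vpair x y)))"

definition spray ::
    "('m, 'i, 'e::banach) atlas \<Rightarrow> nat \<Rightarrow> (('i, 'e) tpoint \<Rightarrow> ('i, 'e) tpoint) \<Rightarrow> bool" where
  "spray M i S \<longleftrightarrow> semispray M i S \<and>
     (\<forall>\<alpha>\<in>Idx M. \<forall>s::real. \<forall>x\<in>overlap M i \<alpha> \<alpha>. \<forall>y\<in>model i.
        spray_coeff M i S \<alpha> x (s *\<^sub>R y) = s\<^sup>2 *\<^sub>R spray_coeff M i S \<alpha> x y)"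


section \<open>The projective limit\<close>

text \<open>
  \<open>Dproj M k i\<close> is \<open>D^k \<pi>_i\<close>, from \<open>T^k(T^(i+1) M)\<close> to \<open>T^k(T^i M)\<close>; and \<open>TMinf M k\<close> is the
  projective limit of the system \<open>(T^k(T^i M), D^k \<pi>_i)\<close>. Thus \<open>k = 0, 1, 2\<close> give \<open>T^\<infinity>M\<close>,
  \<open>TT^\<infinity>M\<close> and \<open>T^2(T^\<infinity>M)\<close>.
\<close>

primrec Dproj ::
    "('m, 'i, 'e::banach) atlas \<Rightarrow> nat \<Rightarrow> nat \<Rightarrow> ('i, 'e) tpoint \<Rightarrow> ('i, 'e) tpoint" where
  "Dproj M 0 i = proj"
| "Dproj M (Suc k) i = Dmap M (Suc i + k) (Dproj M k i)"

definition TMinf :: "('m, 'i, 'e::banach) atlas \<Rightarrow> nat \<Rightarrow> (nat \<Rightarrow> ('i, 'e) tpoint) set" where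
  "TMinf M k = {\<xi>. \<forall>i. \<xi> i \<in> TM M (i + k) \<and> Dproj M k i (\<xi> (Suc i)) = \<xi> i}"

text \<open>
  \<open>E_\<infinity>\<close> consists of the coherent sequences \<open>(x_i)\<close> with \<open>x_i\<close> in \<open>E_i\<close>. Such a sequence is stored
  with its arguments transposed, as \<open>c :: nat \<Rightarrow> nat \<Rightarrow> 'e\<close> with \<open>c j i\<close> the \<open>j\<close>-th coordinate of
  \<open>x_i\<close>. Then \<open>vpair\<close>, \<open>Tset\<close>, \<open>smooth\<close> etc. apply with \<open>'a = nat \<Rightarrow> 'e\<close>, pairing being done
  at every \<open>i\<close>: \<open>lcomp (vpair c d) i = vpair (lcomp c i) (lcomp d i)\<close>.
\<close>

definition lcomp :: "(nat \<Rightarrow> nat \<Rightarrow> 'e) \<Rightarrow> nat \<Rightarrow> (nat \<Rightarrow> 'e)" where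
  "lcomp c i = (\<lambda>j. c j i)"

definition model_inf :: "(nat \<Rightarrow> nat \<Rightarrow> 'e::banach) set" where
  "model_inf = {c. \<forall>i. lcomp c i \<in> model i \<and> vfst (lcomp c (Suc i)) = lcomp c i}"

definition dom_inf :: "('m, 'i, 'e::banach) atlas \<Rightarrow> 'i \<Rightarrow> (nat \<Rightarrow> nat \<Rightarrow> 'e) set" where
  "dom_inf M \<alpha> = {c \<in> model_inf. \<forall>i. lcomp c i \<in> overlap M i \<alpha> \<alpha>}"

text \<open>The representative of a vector field on \<open>TT^\<infinity>M\<close> in the limit charts given by \<open>\<alpha>\<close>.\<close>

definition loc_rep_inf ::
    "('m, 'i, 'e::banach) atlas \<Rightarrow> ((nat \<Rightarrow> ('i, 'e) tpoint) \<Rightarrow> (nat \<Rightarrow> ('i, 'e) tpoint))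
      \<Rightarrow> 'i \<Rightarrow> (nat \<Rightarrow> nat \<Rightarrow> 'e) \<Rightarrow> (nat \<Rightarrow> nat \<Rightarrow> 'e)" where
  "loc_rep_inf M S \<alpha> c = (\<lambda>j i. coord (S (\<lambda>l. tpt M (Suc l) \<alpha> (lcomp c l)) i) \<alpha> j)"

text \<open>
  A vector field on \<open>TT^\<infinity>M\<close>. The bundle projection of \<open>T(TT^\<infinity>M) = lim T(T(T^i M))\<close> is the limit
  of the projections \<open>\<pi>_(i+1)\<close>. The chart of \<open>TT^\<infinity>M\<close> given by \<open>\<alpha>\<close> has image
  \<open>Tset model_inf (dom_inf M \<alpha>)\<close>, which is \<open>U_(\<alpha>_\<infinity>) \<times> E_\<infinity>\<close>.
\<close>

definition vector_field_inf ::
    "('m, 'i, 'e::banach) atlas \<Rightarrow> ((nat \<Rightarrow> ('i, 'e) tpoint) \<Rightarrow> (nat \<Rightarrow> ('i, 'e) tpoint)) \<Rightarrow> bool" where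
  "vector_field_inf M S \<longleftrightarrow>
     (\<forall>\<xi>\<in>TMinf M 1. S \<xi> \<in> TMinf M 2 \<and> (\<lambda>i. proj (S \<xi> i)) = \<xi>) \<and>
     (\<forall>\<alpha>\<in>Idx M. smooth (Tset model_inf model_inf) (Tset model_inf (dom_inf M \<alpha>))
        (loc_rep_inf M S \<alpha>))"

text \<open>
  The tangent map of \<open>\<pi>_(T^\<infinity>M) = lim \<pi>_i : TT^\<infinity>M \<rightarrow> T^\<infinity>M\<close> is the limit of the maps
  \<open>D \<pi>_i : T(T(T^i M)) \<rightarrow> T(T^i M)\<close>.
\<close>

definition Dpi_inf ::
    "('m, 'i, 'e::banach) atlas \<Rightarrow> (nat \<Rightarrow> ('i, 'e) tpoint) \<Rightarrow> (nat \<Rightarrow> ('i, 'e) tpoint)" where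
  "Dpi_inf M \<zeta> = (\<lambda>i. Dmap M (Suc i) proj (\<zeta> i))"

definition semispray_inf ::
    "('m, 'i, 'e::banach) atlas \<Rightarrow> ((nat \<Rightarrow> ('i, 'e) tpoint) \<Rightarrow> (nat \<Rightarrow> ('i, 'e) tpoint)) \<Rightarrow> bool" where
  "semispray_inf M S \<longleftrightarrow> vector_field_inf M S \<and> (\<forall>\<xi>\<in>TMinf M 1. Dpi_inf M (S \<xi>) = \<xi>)"

definition spray_coeff_inf ::
    "('m, 'i, 'e::banach) atlas \<Rightarrow> ((nat \<Rightarrow> ('i, 'e) tpoint) \<Rightarrow> (nat \<Rightarrow> ('i, 'e) tpoint))
      \<Rightarrow> 'i \<Rightarrow> (nat \<Rightarrow> nat \<Rightarrow> 'e) \<Rightarrow> (nat \<Rightarrow> nat \<Rightarrow> 'e) \<Rightarrow> (nat \<Rightarrow> nat \<Rightarrow> 'e)" where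
  "spray_coeff_inf M S \<alpha> x y = (- 1 / 2) *\<^sub>R vsnd (vsnd (loc_rep_inf M S \<alpha> (vpair x y)))"

definition spray_inf ::
    "('m, 'i, 'e::banach) atlas \<Rightarrow> ((nat \<Rightarrow> ('i, 'e) tpoint) \<Rightarrow> (nat \<Rightarrow> ('i, 'e) tpoint)) \<Rightarrow> bool" where
  "spray_inf M S \<longleftrightarrow> semispray_inf M S \<and>
     (\<forall>\<alpha>\<in>Idx M. \<forall>s::real. \<forall>x\<in>dom_inf M \<alpha>. \<forall>y\<in>model_inf.
        spray_coeff_inf M S \<alpha> x (s *\<^sub>R y) = s\<^sup>2 *\<^sub>R spray_coeff_inf M S \<alpha> x y)"

definition clift_inf ::
    "('m, 'i, 'e::banach) atlas \<Rightarrow> (('i, 'e) tpoint \<Rightarrow> ('i, 'e) tpoint)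
      \<Rightarrow> (nat \<Rightarrow> ('i, 'e) tpoint) \<Rightarrow> (nat \<Rightarrow> ('i, 'e) tpoint)" where
  "clift_inf M S \<xi> = (\<lambda>i. clift_iter M S i (\<xi> i))"

end

theory Submission
  imports Defs
begin

text \<open>
  All maps involved (vector fields, \<open>\<kappa>\<close>, projections) preserve the base point in \<open>M\<close>, so each has a
  representative inside a single chart, and tangent maps act on such representatives by the chain
  rule. That \<open>\<kappa>\<close> is represented by the exchange of the two middle components is the symmetry of
  second derivatives of the coordinate changes. If \<open>S\<close> is \<open>(x, z) \<mapsto> (x, z; z, K(x, z))\<close> in a chart, then
  \<open>S\<^sup>c\<close> is \<open>((x, y), (z, w)) \<mapsto> ((x, y), (z, w); (z, w), (K(x, z), dK(x, z)(y, w)))\<close>, and differentiating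
  \<open>K(x, s z) = s\<^sup>2 K(x, z)\<close> in the direction \<open>(y, w)\<close> shows that the new coefficient is again
  2-homogeneous. In the limit charts everything is computed level by level, directional
  derivatives included, so the limit statement needs no calculus beyond the finite levels.
\<close>

text \<open>The finite-level calculus lives on \<open>nat \<Rightarrow> 'a\<close> with the product
  topology, a type that carries no norm. The data available are directional derivatives and
  continuity of the tangent map jointly in point and direction. Estimates are therefore made in one
  coordinate at a time, where values lie in a normed space, by the mean value inequality along a
  segment; joint continuity supplies the uniformity that yields the chain rule.

  \<open>Dmap\<close> collects contributions from all charts around a point and around its image. A
  tangent map can be read off in one chart only after these contributions have been shown to agree,
  which rests on the cocycle identity at every level.

  For the limit to make sense the lifts must also be compatible with the connecting maps. Applied to
  the displayed form of \<open>S\<^sup>c\<close>, the second tangent map of the projection drops y,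
  w and dK and leaves (x, z; z, K(x, z)), which is S at (x, z), the image of ((x, y), (z, w)) under
  the tangent map of the projection.\<close>

section \<open>Interleaved pairs as a linear and topological product\<close>

lemma vfst_vpair [simp]: "vfst (vpair x y) = x"
  by (simp add: vfst_def vpair_def)

lemma vsnd_vpair [simp]: "vsnd (vpair x y) = y"
  by (simp add: vsnd_def vpair_def)

lemma vpair_vfst_vsnd [simp]: "vpair (vfst c) (vsnd c) = c"
  by (auto simp: vfst_def vsnd_def vpair_def fun_eq_iff elim: oddE)

lemma vpair_eq_iff [simp]: "vpair x y = vpair x' y' \<longleftrightarrow> x = x' \<and> y = y'"
  by (metis vfst_vpair vsnd_vpair)

lemma eq_iff_vfst_vsnd: "c = d \<longleftrightarrow> vfst c = vfst d \<and> vsnd c = vsnd d"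
  by (metis vpair_vfst_vsnd)

lemma Tset_iff: "c \<in> Tset X U \<longleftrightarrow> vfst c \<in> U \<and> vsnd c \<in> X"
  unfolding Tset_def by (auto, metis vpair_vfst_vsnd)

lemma vpair_Tset [simp]: "vpair x v \<in> Tset X U \<longleftrightarrow> x \<in> U \<and> v \<in> X"
  by (simp add: Tset_iff)

lemma scaleR_fun_apply [simp]: "(r *\<^sub>R f) x = r *\<^sub>R f x"
  by (simp add: scaleR_fun_def)

lemma vfst_plus [simp]: "vfst (c + d) = vfst c + vfst d"
  and vsnd_plus [simp]: "vsnd (c + d) = vsnd c + vsnd d"
  and vfst_minus [simp]: "vfst (c - d) = vfst c - vfst d"
  and vsnd_minus [simp]: "vsnd (c - d) = vsnd c - vsnd d"
  and vfst_scaleR [simp]: "vfst (r *\<^sub>R c) = r *\<^sub>R vfst c"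
  and vsnd_scaleR [simp]: "vsnd (r *\<^sub>R c) = r *\<^sub>R vsnd c"
  by (simp_all add: vfst_def vsnd_def fun_eq_iff)

lemma vpair_plus: "vpair a b + vpair c d = vpair (a + c) (b + d)"
  and vpair_scaleR: "r *\<^sub>R vpair a b = vpair (r *\<^sub>R a) (r *\<^sub>R b)"
  by (auto simp: vpair_def fun_eq_iff)

lemma vfst_zero [simp]: "vfst 0 = 0" and vsnd_zero [simp]: "vsnd 0 = 0"
  by (simp_all add: vfst_def vsnd_def fun_eq_iff)

text \<open>The gateway to norm estimates: a limit of functions is reduced to limits of single
  coordinates.\<close>

lemma tendsto_coordinatewise:
  fixes f :: "'c \<Rightarrow> 'i \<Rightarrow> 'b::topological_space"
  shows "(f \<longlongrightarrow> l) F \<longleftrightarrow> (\<forall>j. ((\<lambda>x. f x j) \<longlongrightarrow> l j) F)"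
  using limitin_componentwise[of "\<lambda>_. euclidean :: 'b topology" UNIV f l F]
  by (simp add: euclidean_product_topology)

lemma continuous_on_vfst: "continuous_on S (vfst :: (nat \<Rightarrow> 'b::topological_space) \<Rightarrow> _)"
  and continuous_on_vsnd: "continuous_on S (vsnd :: (nat \<Rightarrow> 'b::topological_space) \<Rightarrow> _)"
  unfolding vfst_def vsnd_def by (auto intro!: continuous_on_coordinatewise_then_product
      continuous_on_subset[OF continuous_on_product_coordinates])

lemma tendsto_vpair:
  "(f \<longlongrightarrow> l) F \<Longrightarrow> (g \<longlongrightarrow> m) F \<Longrightarrow> ((\<lambda>x. vpair (f x) (g x)) \<longlongrightarrow> vpair l m) F"
  by (auto simp: tendsto_coordinatewise vpair_def)

lemma tendsto_vpair_iff:
  "(f \<longlongrightarrow> l) F \<longleftrightarrow> ((\<lambda>x. vfst (f x)) \<longlongrightarrow> vfst l) F \<and> ((\<lambda>x. vsnd (f x)) \<longlongrightarrow> vsnd l) F"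
proof
  assume "((\<lambda>x. vfst (f x)) \<longlongrightarrow> vfst l) F \<and> ((\<lambda>x. vsnd (f x)) \<longlongrightarrow> vsnd l) F"
  then show "(f \<longlongrightarrow> l) F"
    using tendsto_vpair[of "\<lambda>x. vfst (f x)" "vfst l" F "\<lambda>x. vsnd (f x)" "vsnd l"] by simp
qed (auto simp: tendsto_coordinatewise vfst_def vsnd_def)

lemma continuous_on_vpair:
  "continuous_on S f \<Longrightarrow> continuous_on S g \<Longrightarrow> continuous_on S (\<lambda>x. vpair (f x) (g x))"
  unfolding continuous_on_def by (auto intro: tendsto_vpair)

section \<open>Model subspaces\<close>

text \<open>Closedness keeps limits of difference quotients of an \<open>X\<close>-valued map inside
  \<open>X\<close>, so that a derivative is again an admissible direction.\<close>

definition closed_sub :: "(nat \<Rightarrow> 'a::{real_vector,topological_space}) set \<Rightarrow> bool" where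
  "closed_sub X \<longleftrightarrow> subspace X \<and> closed X"

definition relopen :: "(nat \<Rightarrow> 'a::{real_vector,topological_space}) set \<Rightarrow> (nat \<Rightarrow> 'a) set \<Rightarrow> bool"
  where "relopen X U \<longleftrightarrow> closed_sub X \<and> (\<exists>W. open W \<and> U = X \<inter> W)"

lemma closed_subD:
  assumes "closed_sub X"
  shows "0 \<in> X" "x \<in> X \<Longrightarrow> y \<in> X \<Longrightarrow> x + y \<in> X" "x \<in> X \<Longrightarrow> r *\<^sub>R x \<in> X"
    "x \<in> X \<Longrightarrow> y \<in> X \<Longrightarrow> x - y \<in> X"
  using assms by (auto simp: closed_sub_def subspace_0 subspace_add subspace_scale subspace_diff)

lemma closed_sub_Tset: "closed_sub X \<Longrightarrow> closed_sub (Tset X X)"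
proof -
  assume X: "closed_sub X"
  have "Tset X X = vfst -` X \<inter> vsnd -` X"
    by (auto simp: Tset_iff)
  then have "closed (Tset X X)"
    using X by (auto simp: closed_sub_def
        intro!: closed_Int closed_vimage continuous_on_vfst continuous_on_vsnd)
  moreover have "subspace (Tset X X)"
    using closed_subD[OF X] by (auto simp: subspace_def Tset_iff)
  ultimately show ?thesis by (simp add: closed_sub_def)
qed

lemma relopen_Tset: "relopen X U \<Longrightarrow> relopen (Tset X X) (Tset X U)"
proof -
  assume U: "relopen X U"
  then obtain W where W: "open W" "U = X \<inter> W" by (auto simp: relopen_def)
  have "open (vfst -` W)" using W(1) continuous_on_vfst by (rule open_vimage)
  moreover have "Tset X U = Tset X X \<inter> vfst -` W" using W by (auto simp: Tset_iff)
  ultimately show ?thesis using U by (auto simp: relopen_def closed_sub_Tset)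
qed

lemma relopen_Int: "relopen X U \<Longrightarrow> relopen X V \<Longrightarrow> relopen X (U \<inter> V)"
proof -
  assume "relopen X U" "relopen X V"
  then obtain W W' where "open W" "U = X \<inter> W" "open W'" "V = X \<inter> W'" "closed_sub X"
    unfolding relopen_def by blast
  then show ?thesis unfolding relopen_def by (intro conjI exI[of _ "W \<inter> W'"]) auto
qed

lemma relopenD: "relopen X U \<Longrightarrow> closed_sub X" "relopen X U \<Longrightarrow> x \<in> U \<Longrightarrow> x \<in> X"
  by (auto simp: relopen_def)

lemma relopen_eventually:
  assumes "relopen X U" "(g \<longlongrightarrow> x) F" "x \<in> U" "eventually (\<lambda>t. g t \<in> X) F"
  shows "eventually (\<lambda>t. g t \<in> U) F"
proof -
  obtain W where W: "open W" "U = X \<inter> W" using assms by (auto simp: relopen_def)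
  have "eventually (\<lambda>t. g t \<in> W) F" using assms W by (auto dest: topological_tendstoD)
  with assms(4) show ?thesis by eventually_elim (use W in auto)
qed

text \<open>Base point, parameter and direction may all move, as they do in the chain rule and in
  second differences.\<close>

lemma tendsto_line:
  fixes x v :: "nat \<Rightarrow> 'a::real_normed_vector"
  assumes "(p \<longlongrightarrow> x) F" "(s \<longlongrightarrow> r) F" "(w \<longlongrightarrow> v) F"
  shows "((\<lambda>t. p t + s t *\<^sub>R w t) \<longlongrightarrow> x + r *\<^sub>R v) F"
  using assms by (auto simp: tendsto_coordinatewise intro!: tendsto_intros)

lemma eventually_line:
  fixes x v :: "nat \<Rightarrow> 'a::real_normed_vector"
  assumes "relopen X U" "x \<in> U" "v \<in> X"
  shows "\<forall>\<^sub>F t in at 0. x + t *\<^sub>R v \<in> U"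
proof (rule relopen_eventually[OF assms(1) _ assms(2)])
  show "((\<lambda>t. x + t *\<^sub>R v) \<longlongrightarrow> x) (at 0)"
    using tendsto_line[of "\<lambda>_. x" x "at 0" "\<lambda>t. t" 0 "\<lambda>_. v" v] by simp
  show "\<forall>\<^sub>F t in at 0. x + t *\<^sub>R v \<in> X"
    using assms by (auto simp: relopenD closed_subD)
qed

section \<open>Directional derivatives\<close>

lemma has_dir_deriv_unique:
  fixes f :: "'a::real_vector \<Rightarrow> 'b::{real_vector,t2_space}"
  shows "has_dir_deriv f x v d \<Longrightarrow> has_dir_deriv f x v d' \<Longrightarrow> d = d'"
  unfolding has_dir_deriv_def by (rule tendsto_unique[OF trivial_limit_at])

lemma dir_deriv_eqI:
  fixes f :: "'a::real_vector \<Rightarrow> 'b::{real_vector,t2_space}"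
  shows "has_dir_deriv f x v d \<Longrightarrow> dir_deriv f x v = d"
  unfolding dir_deriv_def by (blast intro: has_dir_deriv_unique)

lemma dir_deriv_works:
  fixes f :: "'a::real_vector \<Rightarrow> 'b::{real_vector,t2_space}"
  shows "\<exists>d. has_dir_deriv f x v d \<Longrightarrow> has_dir_deriv f x v (dir_deriv f x v)"
  using dir_deriv_eqI by blast

lemma has_dir_deriv_cong_ev:
  assumes "\<forall>\<^sub>F t in at 0. f (x + t *\<^sub>R v) = g (x + t *\<^sub>R v)" "f x = g x"
  shows "has_dir_deriv f x v d \<longleftrightarrow> has_dir_deriv g x v d"
  unfolding has_dir_deriv_def
  by (rule filterlim_cong[OF refl refl], rule eventually_mono[OF assms(1)]) (simp add: assms(2))

lemma has_dir_deriv_cong: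
  fixes f :: "(nat \<Rightarrow> 'a::real_normed_vector) \<Rightarrow> 'b::{real_vector,topological_space}"
  assumes "relopen X U" "x \<in> U" "v \<in> X" "\<And>y. y \<in> U \<Longrightarrow> f y = g y"
  shows "has_dir_deriv f x v d \<longleftrightarrow> has_dir_deriv g x v d"
  by (rule has_dir_deriv_cong_ev) (use assms eventually_mono[OF eventually_line[OF assms(1-3)]] in auto)

lemma Tmap_cong:
  fixes f :: "(nat \<Rightarrow> 'a::real_normed_vector) \<Rightarrow> nat \<Rightarrow> 'b::{real_vector,topological_space}"
  assumes "relopen X U" "c \<in> Tset X U" "\<And>y. y \<in> U \<Longrightarrow> f y = g y"
  shows "Tmap f c = Tmap g c"
  using has_dir_deriv_cong[OF assms(1) _ _ assms(3)] assms(2-3)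
  by (simp add: Tmap_def dir_deriv_def Tset_iff)

text \<open>A short piece of a line through a point of \<open>U\<close> stays in \<open>U\<close>,
  so derivatives see only values on \<open>U\<close>. The tangent maps then agree on
  \<open>Tset X U\<close>, again relatively open, and the induction continues there.\<close>

lemma C_diff_cong:
  fixes f :: "(nat \<Rightarrow> 'a::real_normed_vector) \<Rightarrow> nat \<Rightarrow> 'b::{real_vector,topological_space}"
  assumes "relopen X U" "\<And>y. y \<in> U \<Longrightarrow> f y = g y" "C_diff k X U f"
  shows "C_diff k X U g"
  using assms
proof (induction k arbitrary: X U f g)
  case 0
  then show ?case using continuous_on_cong by fastforce
next
  case (Suc k)
  have "C_diff k (Tset X X) (Tset X U) (Tmap g)"
  proof (rule Suc.IH[OF relopen_Tset[OF Suc.prems(1)]])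
    show "Tmap f c = Tmap g c" if "c \<in> Tset X U" for c
      using Suc.prems(1) that Suc.prems(2) by (rule Tmap_cong)
    show "C_diff k (Tset X X) (Tset X U) (Tmap f)" using Suc.prems(3) by simp
  qed
  with Suc.prems has_dir_deriv_cong[OF Suc.prems(1) _ _ Suc.prems(2)] show ?case by auto
qed

lemma C_diff_subset: "C_diff k X U f \<Longrightarrow> V \<subseteq> U \<Longrightarrow> C_diff k X V f"
proof (induction k arbitrary: X U V f)
  case (Suc k)
  have "Tset X V \<subseteq> Tset X U" using Suc.prems by (auto simp: Tset_iff)
  then have "C_diff k (Tset X X) (Tset X V) (Tmap f)" using Suc.prems by (auto intro: Suc.IH)
  then show ?case using Suc.prems by auto
qed (auto intro: continuous_on_subset)

text \<open>Along the zero section x to (x, 0) the first component of the tangent map is f, so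
  continuity of \<open>Tmap f\<close> contains that of f.\<close>

lemma C_diff_Suc_cont:
  fixes f :: "(nat \<Rightarrow> 'a::{real_vector,topological_space}) \<Rightarrow> nat \<Rightarrow> 'b::{real_vector,topological_space}"
  assumes "0 \<in> X" "continuous_on (Tset X U) (Tmap f)"
  shows "continuous_on U f"
proof -
  have "continuous_on U (\<lambda>x. vfst (Tmap f (vpair x 0)))"
  proof (rule continuous_on_compose2[OF continuous_on_vfst[of UNIV]])
    show "continuous_on U (\<lambda>x. Tmap f (vpair x 0))"
      by (rule continuous_on_compose2[OF assms(2)])
        (use assms(1) in \<open>auto intro!: continuous_on_vpair simp: continuous_on_id\<close>)
  qed simp
  then show ?thesis by (simp add: Tmap_def)
qed

lemma C_diff_Suc_D:
  fixes f :: "(nat \<Rightarrow> 'a::{real_vector,topological_space}) \<Rightarrow> nat \<Rightarrow> 'b::{real_vector,topological_space}"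
  assumes "closed_sub X" "C_diff (Suc k) X U f"
  shows "C_diff k X U f"
  using assms
proof (induction k arbitrary: X U f)
  case 0
  then show ?case using C_diff_Suc_cont[OF closed_subD(1)] by auto
next
  case (Suc k)
  from Suc.prems(2) have "C_diff (Suc k) (Tset X X) (Tset X U) (Tmap f)" by (subst (asm) C_diff.simps) blast
  from Suc.IH[OF closed_sub_Tset[OF Suc.prems(1)] this] show ?case using Suc.prems by auto
qed

lemma C_diff_mono:
  fixes f :: "(nat \<Rightarrow> 'a::{real_vector,topological_space}) \<Rightarrow> nat \<Rightarrow> 'b::{real_vector,topological_space}"
  assumes "closed_sub X" "C_diff k X U f" "m \<le> k"
  shows "C_diff m X U f"
  using assms(3,2) by (induction rule: inc_induct) (blast intro: C_diff_Suc_D[OF assms(1)])+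

section \<open>Chain rule and symmetry of second derivatives\<close>

text \<open>Restricted to a line and to one coordinate, a directional derivative is an ordinary
  derivative in a real parameter, to which the mean value inequality applies.\<close>

lemma has_dir_deriv_along_line:
  fixes f :: "'a::real_vector \<Rightarrow> nat \<Rightarrow> 'b::real_normed_vector"
  assumes "has_dir_deriv f (p + s *\<^sub>R w) w d"
  shows "((\<lambda>r. f (p + r *\<^sub>R w) j) has_vector_derivative d j) (at s)"
proof -
  have "((\<lambda>t. (f (p + (s + t) *\<^sub>R w) j - f (p + s *\<^sub>R w) j) /\<^sub>R t) \<longlongrightarrow> d j) (at 0)"
    using assms by (simp add: has_dir_deriv_def tendsto_coordinatewise algebra_simps)
  from LIM_offset[OF this, of "-s"]
  have *: "((\<lambda>t. (f (p + t *\<^sub>R w) j - f (p + s *\<^sub>R w) j) /\<^sub>R (t - s)) \<longlongrightarrow> d j) (at s)"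
    by simp
  show ?thesis
    unfolding has_vector_derivative_def has_derivative_within
  proof (intro conjI)
    show "bounded_linear (\<lambda>x. x *\<^sub>R d j)" by (rule bounded_linear_scaleR_left)
    have "((\<lambda>t. norm ((f (p + t *\<^sub>R w) j - f (p + s *\<^sub>R w) j) /\<^sub>R (t - s) - d j)) \<longlongrightarrow> 0) (at s)"
      using * by (simp add: LIM_zero_iff tendsto_norm_zero_iff)
    then have "((\<lambda>t. norm ((1 / norm (t - s)) *\<^sub>R
        (f (p + t *\<^sub>R w) j - (f (p + s *\<^sub>R w) j + (t - s) *\<^sub>R d j)))) \<longlongrightarrow> 0) (at s)"
    proof (rule Lim_transform_eventually)
      show "\<forall>\<^sub>F t in at s. norm ((f (p + t *\<^sub>R w) j - f (p + s *\<^sub>R w) j) /\<^sub>R (t - s) - d j) =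
        norm ((1 / norm (t - s)) *\<^sub>R
        (f (p + t *\<^sub>R w) j - (f (p + s *\<^sub>R w) j + (t - s) *\<^sub>R d j)))"
        unfolding eventually_at_filter
      proof (intro always_eventually allI impI)
        fix t assume "t \<noteq> s"
        let ?A = "f (p + t *\<^sub>R w) j - f (p + s *\<^sub>R w) j"
        have "?A /\<^sub>R (t - s) - d j = (?A - (t - s) *\<^sub>R d j) /\<^sub>R (t - s)"
          using \<open>t \<noteq> s\<close> by (simp add: scaleR_diff_right)
        then show "norm (?A /\<^sub>R (t - s) - d j) =
          norm ((1 / norm (t - s)) *\<^sub>R
            (f (p + t *\<^sub>R w) j - (f (p + s *\<^sub>R w) j + (t - s) *\<^sub>R d j)))"
          by (simp only: norm_scaleR diff_diff_eq[symmetric]) (simp add: divide_inverse_commute)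
      qed
    qed
    then show "((\<lambda>t. (1 / norm (t - s)) *\<^sub>R
        (f (p + t *\<^sub>R w) j - (f (p + s *\<^sub>R w) j + (t - s) *\<^sub>R d j))) \<longlongrightarrow> 0) (at s)"
      by (rule tendsto_norm_zero_cancel)
  qed
qed

text \<open>The function h t - t L has derivative h' s - L, of norm at most e on the segment. Using
  \<open>closed_segment\<close> covers both signs of t.\<close>

lemma mean_value_bound:
  fixes h :: "real \<Rightarrow> 'b::real_normed_vector"
  assumes "\<And>s. s \<in> closed_segment 0 t \<Longrightarrow> (h has_vector_derivative h' s) (at s)"
    and "\<And>s. s \<in> closed_segment 0 t \<Longrightarrow> norm (h' s - L) \<le> e"
  shows "norm (h t - h 0 - t *\<^sub>R L) \<le> \<bar>t\<bar> * e"
proof -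
  have "norm ((h t - t *\<^sub>R L) - (h 0 - 0 *\<^sub>R L)) \<le> e * norm (t - 0)"
  proof (rule differentiable_bound[where S = "closed_segment 0 t"])
    fix s assume s: "s \<in> closed_segment 0 t"
    have "((\<lambda>t. h t - t *\<^sub>R L) has_vector_derivative (h' s - L)) (at s)"
      using assms(1)[OF s] by (auto intro!: derivative_eq_intros)
    then show "((\<lambda>t. h t - t *\<^sub>R L) has_derivative (\<lambda>r. r *\<^sub>R (h' s - L))) (at s within closed_segment 0 t)"
      unfolding has_vector_derivative_def by (rule has_derivative_at_withinI)
    show "onorm (\<lambda>r. r *\<^sub>R (h' s - L)) \<le> e"
      using assms(2)[OF s] by (intro onorm_le) (metis mult.commute mult_right_mono norm_ge_zero norm_scaleR real_norm_def)
  qed auto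
  moreover have "(h t - t *\<^sub>R L) - (h 0 - 0 *\<^sub>R L) = h t - h 0 - t *\<^sub>R L" by simp
  ultimately show ?thesis by (metis diff_zero mult.commute real_norm_def)
qed

lemma C_diff_has_dir_deriv:
  fixes g :: "(nat \<Rightarrow> 'a::{real_vector,topological_space}) \<Rightarrow> nat \<Rightarrow> 'b::real_normed_vector"
  assumes "C_diff (Suc k) Y V g" "p \<in> V" "w \<in> Y"
  shows "has_dir_deriv g p w (dir_deriv g p w)"
  using assms by (intro dir_deriv_works) auto

text \<open>A product with a principal filter encodes uniformity over the set \<open>S\<close>; the
  chain rule uses it with the unit interval.\<close>

lemma eventually_prod_principal_right:
  "eventually P (F \<times>\<^sub>F principal S) \<Longrightarrow> \<forall>\<^sub>F x in F. \<forall>y\<in>S. P (x, y)"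
  unfolding eventually_prod_filter eventually_principal
  by (auto elim!: eventually_mono)

text \<open>Write f(x + t v) = p + t w(t) with w(t) tending to u. On the segment from p to p + t
  w(t) the derivative of g in the direction w(t) is uniformly close to that at p in the direction u,
  by continuity of \<open>Tmap g\<close> at (p, u). The mean value inequality converts this into the
  difference quotient.\<close>

lemma has_dir_deriv_chain:
  fixes f :: "(nat \<Rightarrow> 'a::real_vector) \<Rightarrow> nat \<Rightarrow> 'b::real_normed_vector"
    and g :: "(nat \<Rightarrow> 'b) \<Rightarrow> nat \<Rightarrow> 'c::real_normed_vector"
  assumes f: "has_dir_deriv f x v u" and V: "relopen Y V" and g: "C_diff 1 Y V g"
    and x: "f x \<in> V" and ev: "\<forall>\<^sub>F t in at 0. f (x + t *\<^sub>R v) \<in> Y"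
  shows "u \<in> Y" and "has_dir_deriv (\<lambda>x. g (f x)) x v (dir_deriv g (f x) u)"
proof -
  define p where "p = f x"
  define w where "w t = (f (x + t *\<^sub>R v) - f x) /\<^sub>R t" for t
  have Y: "closed_sub Y" using V by (rule relopenD)
  have p: "p \<in> V" using x by (simp add: p_def)
  have w: "(w \<longlongrightarrow> u) (at 0)"
    using f by (simp add: has_dir_deriv_def w_def[abs_def])
  have wY: "\<forall>\<^sub>F t in at 0. w t \<in> Y"
    using ev by eventually_elim (use closed_subD[OF Y] relopenD(2)[OF V x] in \<open>auto simp: w_def\<close>)
  show u: "u \<in> Y"
    using w wY Y by (intro Lim_in_closed_set[of Y w "at 0"]) (auto simp: closed_sub_def)
  have fw: "f (x + t *\<^sub>R v) = p + t *\<^sub>R w t" if "t \<noteq> 0" for t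
    using that by (simp add: w_def p_def)
  \<comment> \<open>A pair (t, r) has t tending to 0 while r ranges over the whole unit interval
    without constraint.\<close>
  define F :: "(real \<times> real) filter" where "F = at 0 \<times>\<^sub>F principal {0..1}"
  \<comment> \<open>The tangent vector w(t) attached at the fraction r of the segment from p to p +
    t w(t).\<close>
  define G where "G = (\<lambda>z::real \<times> real. vpair (p + (snd z * fst z) *\<^sub>R w (fst z)) (w (fst z)))"
  have fstF: "filterlim fst (at 0) F"
    unfolding F_def by (rule filterlim_fst)
  have wF: "((\<lambda>z. w (fst z)) \<longlongrightarrow> u) F"
    using w fstF by (rule filterlim_compose)
  have sF: "\<forall>\<^sub>F z in F. snd z \<in> {0..1}"
    unfolding F_def by (rule eventually_compose_filterlim[OF _ filterlim_snd]) (simp add: eventually_principal)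
  have "((\<lambda>z. fst z) \<longlongrightarrow> 0) F"
    using fstF filterlim_at by blast
  then have "((\<lambda>z. snd z * fst z) \<longlongrightarrow> 0) F"
    by (rule tendsto_0_le[where K = 1]) (use sF in eventually_elim, auto simp: abs_mult mult_left_le_one_le)
  then have "((\<lambda>z. p + (snd z * fst z) *\<^sub>R w (fst z)) \<longlongrightarrow> p + 0 *\<^sub>R u) F"
    by (intro tendsto_line tendsto_const wF)
  then have G: "(G \<longlongrightarrow> vpair p u) F"
    unfolding G_def using wF by (intro tendsto_vpair) auto
  have GT: "\<forall>\<^sub>F z in F. G z \<in> Tset Y V"
  proof (rule relopen_eventually[OF relopen_Tset[OF V] G])
    have "\<forall>\<^sub>F z in F. w (fst z) \<in> Y"
      by (rule eventually_compose_filterlim[OF wY fstF])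
    then show "\<forall>\<^sub>F z in F. G z \<in> Tset Y Y"
      by eventually_elim (use closed_subD[OF Y] relopenD(2)[OF V p] in \<open>auto simp: G_def\<close>)
  qed (use p u in auto)
  have gc: "continuous_on (Tset Y V) (Tmap g)" using g by simp
  have "((\<lambda>z. Tmap g (G z)) \<longlongrightarrow> Tmap g (vpair p u)) F"
    by (rule continuous_on_tendsto_compose[OF gc G _ GT]) (use p u in auto)
  then have D: "((\<lambda>z. dir_deriv g (vfst (G z)) (vsnd (G z))) \<longlongrightarrow> dir_deriv g p u) F"
    by (subst (asm) tendsto_vpair_iff) (auto simp: Tmap_def)
  show "has_dir_deriv (\<lambda>x. g (f x)) x v (dir_deriv g (f x) u)"
    unfolding has_dir_deriv_def tendsto_coordinatewise
  proof (intro allI tendstoI)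
    \<comment> \<open>The estimate is run with e / 2, since the mean value bound is only a weak
      inequality.\<close>
    fix j and e :: real assume e: "e > 0"
    let ?L = "dir_deriv g p u j"
    have "\<forall>\<^sub>F z in F. dist (dir_deriv g (vfst (G z)) (vsnd (G z)) j) ?L < e / 2"
      using D e by (intro tendstoD[where e = "e / 2"]) (auto simp: tendsto_coordinatewise)
    with GT have "\<forall>\<^sub>F z in F. G z \<in> Tset Y V \<and>
        dist (dir_deriv g (vfst (G z)) (vsnd (G z)) j) ?L < e / 2"
      by eventually_elim auto
    then have "\<forall>\<^sub>F t in at 0. \<forall>r\<in>{0..1}. G (t, r) \<in> Tset Y V \<and>
        dist (dir_deriv g (vfst (G (t, r))) (vsnd (G (t, r))) j) ?L < e / 2"
      unfolding F_def by (rule eventually_prod_principal_right)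
    moreover have "\<forall>\<^sub>F t::real in at 0. t \<noteq> 0" by (simp add: eventually_at_filter)
    ultimately show "\<forall>\<^sub>F t in at 0. dist (((g (f (x + t *\<^sub>R v)) - g (f x)) /\<^sub>R t) j)
        (dir_deriv g (f x) u j) < e"
    proof eventually_elim
      case (elim t)
      have "norm (g (p + t *\<^sub>R w t) j - g (p + 0 *\<^sub>R w t) j - t *\<^sub>R ?L) \<le> \<bar>t\<bar> * (e / 2)"
      proof (rule mean_value_bound)
        fix s assume "s \<in> closed_segment 0 t"
        \<comment> \<open>Every s on the segment, for either sign of t, is a fraction r of t, so the
          bound that is uniform in r applies.\<close>
        then obtain r where r: "r \<in> {0..1}" "s = r * t" by (auto simp: in_segment)
        then have *: "p + s *\<^sub>R w t \<in> V" "w t \<in> Y"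
            "dist (dir_deriv g (p + s *\<^sub>R w t) (w t) j) ?L < e / 2"
          using elim(1) by (auto simp: G_def)
        show "((\<lambda>s. g (p + s *\<^sub>R w t) j) has_vector_derivative
            dir_deriv g (p + s *\<^sub>R w t) (w t) j) (at s)"
          by (rule has_dir_deriv_along_line[OF C_diff_has_dir_deriv[of 0 Y V]]) (use g * in auto)
        show "norm (dir_deriv g (p + s *\<^sub>R w t) (w t) j - ?L) \<le> e / 2"
          using * by (simp add: dist_norm)
      qed
      moreover have "norm ((g (p + t *\<^sub>R w t) j - g p j) /\<^sub>R t - ?L) =
          norm (g (p + t *\<^sub>R w t) j - g p j - t *\<^sub>R ?L) / \<bar>t\<bar>"
      proof -
        have "(g (p + t *\<^sub>R w t) j - g p j) /\<^sub>R t - ?L = (g (p + t *\<^sub>R w t) j - g p j - t *\<^sub>R ?L) /\<^sub>R t"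
          using elim(2) by (simp add: scaleR_diff_right)
        then show ?thesis by (simp only: norm_scaleR) (simp add: divide_inverse_commute)
      qed
      ultimately have "norm ((g (p + t *\<^sub>R w t) j - g p j) /\<^sub>R t - ?L) \<le> e / 2"
        using elim(2) by (simp add: divide_le_eq mult.commute)
      then show ?case using e elim(2) by (simp add: dist_norm fw p_def[symmetric])
    qed
  qed
qed

lemma Tmap_compose:
  fixes f :: "(nat \<Rightarrow> 'a::real_normed_vector) \<Rightarrow> nat \<Rightarrow> 'b::real_normed_vector"
    and g :: "(nat \<Rightarrow> 'b) \<Rightarrow> nat \<Rightarrow> 'c::real_normed_vector"
  assumes "relopen X U" "C_diff 1 X U f" "relopen Y V" "C_diff 1 Y V g" "f ` U \<subseteq> V" "c \<in> Tset X U"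
  shows "Tmap f c \<in> Tset Y V" and "Tmap (\<lambda>x. g (f x)) c = Tmap g (Tmap f c)"
    and "has_dir_deriv (\<lambda>x. g (f x)) (vfst c) (vsnd c) (vsnd (Tmap g (Tmap f c)))"
proof -
  have c: "vfst c \<in> U" "vsnd c \<in> X" using assms(6) by (auto simp: Tset_iff)
  have f: "has_dir_deriv f (vfst c) (vsnd c) (dir_deriv f (vfst c) (vsnd c))"
    using C_diff_has_dir_deriv[of 0] assms(2) c by simp
  have "\<forall>\<^sub>F t in at 0. f (vfst c + t *\<^sub>R vsnd c) \<in> Y"
    using eventually_line[OF assms(1) c] by eventually_elim (use assms relopenD in blast)
  note * = has_dir_deriv_chain[OF f assms(3,4) _ this]
  show "Tmap f c \<in> Tset Y V" using assms(5) c *(1) by (auto simp: Tset_iff Tmap_def)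
  show 1: "has_dir_deriv (\<lambda>x. g (f x)) (vfst c) (vsnd c) (vsnd (Tmap g (Tmap f c)))"
    using assms(5) c *(2) by (auto simp: Tmap_def)
  show "Tmap (\<lambda>x. g (f x)) c = Tmap g (Tmap f c)"
    using dir_deriv_eqI[OF 1] by (simp add: Tmap_def)
qed

text \<open>By functoriality the tangent map of the composite is the composite of the tangent maps,
  both one class lower and defined on tangent domains; hence the induction is over all domains and
  maps at once.\<close>

lemma C_diff_compose:
  fixes f :: "(nat \<Rightarrow> 'a::real_normed_vector) \<Rightarrow> nat \<Rightarrow> 'b::real_normed_vector"
    and g :: "(nat \<Rightarrow> 'b) \<Rightarrow> nat \<Rightarrow> 'c::real_normed_vector"
  assumes "relopen X U" "C_diff k X U f" "relopen Y V" "C_diff k Y V g" "f ` U \<subseteq> V"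
  shows "C_diff k X U (\<lambda>x. g (f x))"
  using assms
proof (induction k arbitrary: X U f Y V g)
  case 0
  then show ?case using continuous_on_compose2 by (metis C_diff.simps(1))
next
  case (Suc k)
  have "C_diff 1 X U f" "C_diff 1 Y V g"
    using Suc.prems by (auto intro: C_diff_mono[where k = "Suc k"] relopenD simp del: C_diff.simps)
  note T = Tmap_compose[OF Suc.prems(1) this(1) Suc.prems(3) this(2) Suc.prems(5)]
  have "C_diff k (Tset X X) (Tset X U) (\<lambda>c. Tmap g (Tmap f c))"
    by (rule Suc.IH[OF relopen_Tset[OF Suc.prems(1)] _ relopen_Tset[OF Suc.prems(3)]])
      (use Suc.prems T(1) in auto)
  then have "C_diff k (Tset X X) (Tset X U) (Tmap (\<lambda>x. g (f x)))"
    by (rule C_diff_cong[OF relopen_Tset[OF Suc.prems(1)], rotated]) (simp add: T(2))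
  moreover have "\<exists>d. has_dir_deriv (\<lambda>x. g (f x)) x v d" if "x \<in> U" "v \<in> X" for x v
    using T(3)[of "vpair x v"] that by auto
  ultimately show ?case by simp
qed

text \<open>
  The second difference is symmetric in \<open>(s, y)\<close> and \<open>(t, z)\<close>, while \<open>L\<close> is not visibly so; this is
  what makes the bound yield symmetry of second derivatives. Adding \<open>s t w\<close> to the argument
  accounts for the last component of the second tangent map in one stroke.
\<close>

lemma second_difference_bound:
  fixes f :: "(nat \<Rightarrow> 'a::real_normed_vector) \<Rightarrow> nat \<Rightarrow> 'b::real_normed_vector"
  assumes U: "relopen X U" and f: "C_diff 2 X U f"
    and x: "x \<in> U" and y: "y \<in> X" and z: "z \<in> X" and w: "w \<in> X" and e: "e > 0"
  defines "L \<equiv> vsnd (dir_deriv (Tmap f) (vpair x y) (vpair z w))"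
  obtains \<delta> where "\<delta> > 0" "\<And>s t. \<bar>s\<bar> < \<delta> \<Longrightarrow> \<bar>t\<bar> < \<delta> \<Longrightarrow>
    norm (f (x + s *\<^sub>R y + t *\<^sub>R z + (s * t) *\<^sub>R w) j - f (x + s *\<^sub>R y) j - f (x + t *\<^sub>R z) j + f x j
      - (s * t) *\<^sub>R L j) \<le> \<bar>s\<bar> * \<bar>t\<bar> * e"
proof -
  have X: "closed_sub X" using U by (rule relopenD)
  note XD = closed_subD[OF X]
  define F :: "(real \<times> real) filter" where "F = nhds 0 \<times>\<^sub>F nhds 0"
  \<comment> \<open>With q(s, t) = x + s y + t z + s t w, this is q with its s-derivative y + t w,
    followed by the t-derivatives z + s w and w of these two. It is the point at which the second
    tangent map computes the mixed derivative of f along q.\<close>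
  define P where "P = (\<lambda>s t. vpair (vpair (x + s *\<^sub>R y + t *\<^sub>R (z + s *\<^sub>R w)) (y + t *\<^sub>R w))
    (vpair (z + s *\<^sub>R w) w))"
  have sF: "(fst \<longlongrightarrow> 0) F" and tF: "(snd \<longlongrightarrow> 0) F"
    unfolding F_def by (rule filterlim_fst, rule filterlim_snd)
  have "((\<lambda>q. P (fst q) (snd q)) \<longlongrightarrow> vpair (vpair (x + 0 *\<^sub>R y + 0 *\<^sub>R (z + 0 *\<^sub>R w)) (y + 0 *\<^sub>R w))
    (vpair (z + 0 *\<^sub>R w) w)) F"
    unfolding P_def by (intro tendsto_vpair tendsto_line tendsto_const sF tF)
  then have P: "((\<lambda>q. P (fst q) (snd q)) \<longlongrightarrow> vpair (vpair x y) (vpair z w)) F" by simp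
  have PX: "P s t \<in> Tset (Tset X X) (Tset X X)" for s t
    using XD y z w relopenD(2)[OF U x] by (auto simp: P_def)
  have PU: "\<forall>\<^sub>F q in F. P (fst q) (snd q) \<in> Tset (Tset X X) (Tset X U)"
    by (rule relopen_eventually[OF relopen_Tset[OF relopen_Tset[OF U]] P])
      (use PX x y z w in auto)
  have f2: "C_diff (Suc (Suc 0)) X U f" using f by (simp only: numeral_2_eq_2)
  then have T1: "C_diff (Suc 0) (Tset X X) (Tset X U) (Tmap f)"
    and T2: "continuous_on (Tset (Tset X X) (Tset X U)) (Tmap (Tmap f))" by auto
  have "((\<lambda>q. Tmap (Tmap f) (P (fst q) (snd q))) \<longlongrightarrow>
      Tmap (Tmap f) (vpair (vpair x y) (vpair z w))) F"
    by (rule continuous_on_tendsto_compose[OF T2 P _ PU]) (use x y z w in auto)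
  then have "((\<lambda>q. vsnd (vsnd (Tmap (Tmap f) (P (fst q) (snd q)))) j) \<longlongrightarrow> L j) F"
    unfolding L_def
    by (subst (asm) tendsto_vpair_iff, subst (asm) (2) tendsto_vpair_iff)
      (auto simp: Tmap_def tendsto_coordinatewise)
  from tendstoD[OF this e] PU
  have "\<forall>\<^sub>F q in F. P (fst q) (snd q) \<in> Tset (Tset X X) (Tset X U) \<and>
      dist (vsnd (vsnd (Tmap (Tmap f) (P (fst q) (snd q)))) j) (L j) < e"
    by eventually_elim auto
  then obtain Q where "eventually Q (nhds (0::real))" and Q: "\<And>s t. Q s \<Longrightarrow> Q t \<Longrightarrow>
      P s t \<in> Tset (Tset X X) (Tset X U) \<and> dist (vsnd (vsnd (Tmap (Tmap f) (P s t))) j) (L j) < e"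
    unfolding F_def eventually_prod_same by auto
  then obtain \<delta> where \<delta>: "\<delta> > 0" "\<And>s. \<bar>s\<bar> < \<delta> \<Longrightarrow> Q s"
    unfolding eventually_nhds_metric by (auto simp: dist_norm)
  show ?thesis
  proof (rule that[OF \<delta>(1)])
    fix s t :: real assume st: "\<bar>s\<bar> < \<delta>" "\<bar>t\<bar> < \<delta>"
    have seg: "\<bar>r'\<bar> < \<delta>" if "r' \<in> closed_segment 0 r" "\<bar>r\<bar> < \<delta>" for r r'
      using that by (auto simp: closed_segment_eq_real_ivl split: if_splits)
    have PQ: "x + s' *\<^sub>R y + t' *\<^sub>R (z + s' *\<^sub>R w) \<in> U"
      "norm (vsnd (dir_deriv (Tmap f) (vfst (P s' t')) (vsnd (P s' t'))) j - L j) \<le> e"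
      if "\<bar>s'\<bar> < \<delta>" "\<bar>t'\<bar> < \<delta>" for s' t'
      using Q[OF \<delta>(2)[OF that(1)] \<delta>(2)[OF that(2)]] by (auto simp: P_def Tmap_def dist_norm)
    \<comment> \<open>The s-derivative of f along q(s, t). Its own t-derivative is the last
      component of the second tangent map at \<open>P\<close>, hence close to L.\<close>
    define \<psi> where "\<psi> s' t' = dir_deriv f (x + s' *\<^sub>R y + t' *\<^sub>R (z + s' *\<^sub>R w)) (y + t' *\<^sub>R w) j" for s' t'
    have \<psi>: "norm (\<psi> s' t - \<psi> s' 0 - t *\<^sub>R L j) \<le> \<bar>t\<bar> * e" if s': "\<bar>s'\<bar> < \<delta>" for s'
    proof (rule mean_value_bound)
      fix t' assume "t' \<in> closed_segment 0 t"
      then have t': "\<bar>t'\<bar> < \<delta>" using st(2) by (rule seg)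
      let ?p = "vpair (x + s' *\<^sub>R y) y" and ?v = "vpair (z + s' *\<^sub>R w) w"
      have P_line: "P s' t' = vpair (?p + t' *\<^sub>R ?v) ?v" for t'
        by (simp add: P_def vpair_plus vpair_scaleR)
      have "has_dir_deriv (Tmap f) (?p + t' *\<^sub>R ?v) ?v (dir_deriv (Tmap f) (?p + t' *\<^sub>R ?v) ?v)"
        by (rule C_diff_has_dir_deriv[OF T1])
          (use PQ(1)[OF s' t'] XD y z w in \<open>auto simp: vpair_plus vpair_scaleR\<close>)
      \<comment> \<open>Interleaving puts coordinate j of the second half at the odd position 2 j +
        1.\<close>
      from has_dir_deriv_along_line[OF this, of "2 * j + 1"]
      show "(\<psi> s' has_vector_derivative
          vsnd (dir_deriv (Tmap f) (vfst (P s' t')) (vsnd (P s' t'))) j) (at t')"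
        by (simp add: P_line Tmap_def \<psi>_def[abs_def] vsnd_def[symmetric])
          (simp add: vsnd_def vpair_def vfst_def fun_eq_iff)
      show "norm (vsnd (dir_deriv (Tmap f) (vfst (P s' t')) (vsnd (P s' t'))) j - L j) \<le> e"
        by (rule PQ(2)[OF s' t'])
    qed
    \<comment> \<open>The increment in t as a function of s; \<phi>(s) - \<phi>(0) is the second
      difference, and the derivative of \<phi> is an increment of \<psi>.\<close>
    define \<phi> where "\<phi> s' = f ((x + t *\<^sub>R z) + s' *\<^sub>R (y + t *\<^sub>R w)) j - f (x + s' *\<^sub>R y) j" for s'
    have \<phi>: "norm (\<phi> s - \<phi> 0 - s *\<^sub>R (t *\<^sub>R L j)) \<le> \<bar>s\<bar> * (\<bar>t\<bar> * e)"
    proof (rule mean_value_bound)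
      fix s' assume "s' \<in> closed_segment 0 s"
      then have s': "\<bar>s'\<bar> < \<delta>" using st(1) by (rule seg)
      have line: "x + t' *\<^sub>R z + s' *\<^sub>R (y + t' *\<^sub>R w) = x + s' *\<^sub>R y + t' *\<^sub>R (z + s' *\<^sub>R w)" for t'
        by (simp add: algebra_simps)
      have d: "has_dir_deriv f ((x + t' *\<^sub>R z) + s' *\<^sub>R (y + t' *\<^sub>R w)) (y + t' *\<^sub>R w)
          (dir_deriv f ((x + t' *\<^sub>R z) + s' *\<^sub>R (y + t' *\<^sub>R w)) (y + t' *\<^sub>R w))" if "\<bar>t'\<bar> < \<delta>" for t'
        by (rule C_diff_has_dir_deriv[OF f2]) (use PQ(1)[OF s' that] XD y w in \<open>auto simp: line\<close>)
      show "(\<phi> has_vector_derivative \<psi> s' t - \<psi> s' 0) (at s')"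
        unfolding \<phi>_def[abs_def] \<psi>_def
        using has_dir_deriv_along_line[OF d[OF st(2)], of j] has_dir_deriv_along_line[OF d[of 0], of j] \<delta>(1)
        by (intro has_vector_derivative_diff) (simp_all add: line)
      show "norm (\<psi> s' t - \<psi> s' 0 - t *\<^sub>R L j) \<le> \<bar>t\<bar> * e" by (rule \<psi>[OF s'])
    qed
    have "x + t *\<^sub>R z + s *\<^sub>R (y + t *\<^sub>R w) = x + s *\<^sub>R y + t *\<^sub>R z + (s * t) *\<^sub>R w"
      by (simp add: algebra_simps)
    note eq = this
    have "\<phi> s - \<phi> 0 - s *\<^sub>R (t *\<^sub>R L j) = f (x + s *\<^sub>R y + t *\<^sub>R z + (s * t) *\<^sub>R w) j
        - f (x + s *\<^sub>R y) j - f (x + t *\<^sub>R z) j + f x j - (s * t) *\<^sub>R L j"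
      unfolding \<phi>_def eq by simp
    with \<phi> show "norm (f (x + s *\<^sub>R y + t *\<^sub>R z + (s * t) *\<^sub>R w) j - f (x + s *\<^sub>R y) j
        - f (x + t *\<^sub>R z) j + f x j - (s * t) *\<^sub>R L j) \<le> \<bar>s\<bar> * \<bar>t\<bar> * e"
      by (simp add: mult.assoc)
  qed
qed

text \<open>On the diagonal s = t the second difference is unchanged by exchanging y and z, so the
  same quantity approximates both s^2 L and s^2 L'.\<close>

lemma second_deriv_symmetric:
  fixes f :: "(nat \<Rightarrow> 'a::real_normed_vector) \<Rightarrow> nat \<Rightarrow> 'b::real_normed_vector"
  assumes U: "relopen X U" and f: "C_diff 2 X U f"
    and x: "x \<in> U" and y: "y \<in> X" and z: "z \<in> X" and w: "w \<in> X"
  shows "vsnd (dir_deriv (Tmap f) (vpair x y) (vpair z w)) =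
    vsnd (dir_deriv (Tmap f) (vpair x z) (vpair y w))" (is "?L = ?L'")
proof (rule ext, rule ccontr)
  fix j assume "?L j \<noteq> ?L' j"
  \<comment> \<open>A third of the gap: two errors of size e cannot bridge a distance of 3
    e.\<close>
  define e where "e = norm (?L j - ?L' j) / 3"
  have e: "e > 0" using \<open>?L j \<noteq> ?L' j\<close> by (simp add: e_def)
  obtain \<delta> where \<delta>: "\<delta> > 0" "\<And>s t. \<bar>s\<bar> < \<delta> \<Longrightarrow> \<bar>t\<bar> < \<delta> \<Longrightarrow>
    norm (f (x + s *\<^sub>R y + t *\<^sub>R z + (s * t) *\<^sub>R w) j - f (x + s *\<^sub>R y) j - f (x + t *\<^sub>R z) j + f x j
      - (s * t) *\<^sub>R ?L j) \<le> \<bar>s\<bar> * \<bar>t\<bar> * e"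
    using second_difference_bound[OF U f x y z w e] by blast
  obtain \<delta>' where \<delta>': "\<delta>' > 0" "\<And>s t. \<bar>s\<bar> < \<delta>' \<Longrightarrow> \<bar>t\<bar> < \<delta>' \<Longrightarrow>
    norm (f (x + s *\<^sub>R z + t *\<^sub>R y + (s * t) *\<^sub>R w) j - f (x + s *\<^sub>R z) j - f (x + t *\<^sub>R y) j + f x j
      - (s * t) *\<^sub>R ?L' j) \<le> \<bar>s\<bar> * \<bar>t\<bar> * e"
    using second_difference_bound[OF U f x z y w e] by blast
  define s where "s = min \<delta> \<delta>' / 2"
  have s: "s > 0" "\<bar>s\<bar> < \<delta>" "\<bar>s\<bar> < \<delta>'" using \<delta>(1) \<delta>'(1) by (auto simp: s_def)
  define A where "A = f (x + s *\<^sub>R y + s *\<^sub>R z + (s * s) *\<^sub>R w) j - f (x + s *\<^sub>R y) j - f (x + s *\<^sub>R z) j + f x j"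
  have 1: "norm (A - (s * s) *\<^sub>R ?L j) \<le> s * s * e"
    using \<delta>(2)[OF s(2) s(2)] s(1) by (simp add: A_def)
  have zy: "x + s *\<^sub>R z + s *\<^sub>R y = x + s *\<^sub>R y + s *\<^sub>R z" by (simp add: add.assoc add.commute)
  have 2: "norm (A - (s * s) *\<^sub>R ?L' j) \<le> s * s * e"
    using \<delta>'(2)[OF s(3) s(3)] s(1) unfolding zy by (simp add: A_def algebra_simps)
  have "norm ((s * s) *\<^sub>R (?L j - ?L' j)) = norm ((A - (s * s) *\<^sub>R ?L' j) - (A - (s * s) *\<^sub>R ?L j))"
    by (simp add: scaleR_diff_right)
  also have "\<dots> \<le> s * s * e + s * s * e"
    using 1 2 norm_triangle_ineq4[of "A - (s * s) *\<^sub>R ?L' j" "A - (s * s) *\<^sub>R ?L j"] by linarith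
  finally have "s * s * (3 * e) \<le> s * s * (2 * e)" by (simp add: e_def)
  with s e show False by (simp add: mult_le_cancel_left)
qed

text \<open>The second tangent map of f has components f x, df x y, df x z and a mixed one. The flip
  exchanges the two middle ones, and the mixed one is fixed by symmetry. For coordinate changes this
  makes \<kappa> independent of the chart.\<close>

lemma Tmap_Tmap_swap_mid:
  fixes f :: "(nat \<Rightarrow> 'a::real_normed_vector) \<Rightarrow> nat \<Rightarrow> 'b::real_normed_vector"
  assumes U: "relopen X U" and f: "C_diff 2 X U f" and c: "c \<in> Tset (Tset X X) (Tset X U)"
  shows "Tmap (Tmap f) (swap_mid c) = swap_mid (Tmap (Tmap f) c)"
proof -
  obtain x y z w where cc: "c = vpair (vpair x y) (vpair z w)"
    by (metis vpair_vfst_vsnd)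
  have *: "x \<in> U" "y \<in> X" "z \<in> X" "w \<in> X" using c by (auto simp: cc)
  have f2: "C_diff (Suc (Suc 0)) X U f" using f by (simp only: numeral_2_eq_2)
  then have T1: "C_diff (Suc 0) (Tset X X) (Tset X U) (Tmap f)" by auto
  \<comment> \<open>The first component of \<open>Tmap f\<close> depends only on the base point and
    equals f there.\<close>
  have "vfst (dir_deriv (Tmap f) (vpair x y) (vpair z w)) = dir_deriv f x z"
    if "x \<in> U" "y \<in> X" "z \<in> X" "w \<in> X" for x y z w
  proof -
    have "has_dir_deriv (Tmap f) (vpair x y) (vpair z w) (dir_deriv (Tmap f) (vpair x y) (vpair z w))"
      by (rule C_diff_has_dir_deriv[OF T1]) (use that in auto)
    then have "has_dir_deriv f x z (vfst (dir_deriv (Tmap f) (vpair x y) (vpair z w)))"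
      unfolding has_dir_deriv_def
      by (subst (asm) tendsto_vpair_iff) (auto simp: Tmap_def)
    then show ?thesis using dir_deriv_eqI by metis
  qed
  from this[of x y z w] this[of x z y w] * second_deriv_symmetric[OF U f *]
  show ?thesis
    by (simp add: cc swap_mid_def Tmap_def) (subst eq_iff_vfst_vsnd, simp)
qed

section \<open>Continuous linear maps\<close>

definition cont_linear ::
    "((nat \<Rightarrow> 'a::real_normed_vector) \<Rightarrow> nat \<Rightarrow> 'b::real_normed_vector) \<Rightarrow> bool" where
  "cont_linear L \<longleftrightarrow> linear L \<and> continuous_on UNIV L"

lemma has_dir_deriv_linear:
  fixes L :: "'a::real_vector \<Rightarrow> 'b::{real_vector,topological_space}"
  assumes "linear L"
  shows "has_dir_deriv L x v (L v)"
  unfolding has_dir_deriv_def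
proof (rule tendsto_eventually)
  have "(L (x + t *\<^sub>R v) - L x) /\<^sub>R t = L v" if "t \<noteq> 0" for t
    using assms that by (simp add: linear_add linear_scale)
  then show "\<forall>\<^sub>F t in at 0. (L (x + t *\<^sub>R v) - L x) /\<^sub>R t = L v"
    by (simp add: eventually_at_filter)
qed

lemma Tmap_linear:
  fixes L :: "(nat \<Rightarrow> 'a::real_normed_vector) \<Rightarrow> nat \<Rightarrow> 'b::real_normed_vector"
  assumes "cont_linear L"
  shows "Tmap L c = vpair (L (vfst c)) (L (vsnd c))"
  using assms by (simp add: Tmap_def cont_linear_def dir_deriv_eqI[OF has_dir_deriv_linear])

lemma cont_linear_vfst: "cont_linear vfst" and cont_linear_vsnd: "cont_linear vsnd"
  and cont_linear_id: "cont_linear (\<lambda>x. x)"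
  by (auto simp: cont_linear_def linear_iff continuous_on_vfst continuous_on_vsnd continuous_on_id)

lemma cont_linear_compose: "cont_linear L \<Longrightarrow> cont_linear L' \<Longrightarrow> cont_linear (\<lambda>x. L (L' x))"
  unfolding cont_linear_def
  by (auto intro: continuous_on_compose2[of UNIV L] simp: linear_iff)

lemma cont_linear_vpair: "cont_linear L \<Longrightarrow> cont_linear L' \<Longrightarrow> cont_linear (\<lambda>x. vpair (L x) (L' x))"
  unfolding cont_linear_def
  by (auto intro!: continuous_on_vpair simp: linear_iff vpair_plus vpair_scaleR)

lemma cont_linear_Tmap:
  assumes "cont_linear L"
  shows "cont_linear (Tmap L)"
proof -
  have "cont_linear (\<lambda>c. vpair (L (vfst c)) (L (vsnd c)))"
    by (intro cont_linear_vpair cont_linear_compose[OF assms] cont_linear_vfst cont_linear_vsnd)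
  then show ?thesis by (simp add: Tmap_linear[OF assms, abs_def])
qed

lemma cont_linear_swap_mid: "cont_linear swap_mid"
  unfolding swap_mid_def[abs_def]
  by (intro cont_linear_vpair cont_linear_compose[OF cont_linear_vfst cont_linear_vfst]
      cont_linear_compose[OF cont_linear_vfst cont_linear_vsnd]
      cont_linear_compose[OF cont_linear_vsnd cont_linear_vfst]
      cont_linear_compose[OF cont_linear_vsnd cont_linear_vsnd])

text \<open>The derivative of L at any point is L, so the tangent map is L in each half, again
  continuous and linear.\<close>

lemma C_diff_linear: "cont_linear L \<Longrightarrow> C_diff k X U L"
proof (induction k arbitrary: X U L)
  case 0
  then show ?case by (auto simp: cont_linear_def intro: continuous_on_subset)
next
  case (Suc k)
  then have "linear L" "C_diff k (Tset X X) (Tset X U) (Tmap L)"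
    using Suc.IH[OF cont_linear_Tmap[OF Suc.prems]] by (auto simp: cont_linear_def)
  then show ?case by (auto intro: has_dir_deriv_linear)
qed

section \<open>Charts of the higher tangent bundles\<close>

lemma closed_sub_model: "closed_sub (model r :: (nat \<Rightarrow> 'e::real_normed_vector) set)"
proof (induction r)
  case 0
  have eq: "range base = (\<Inter>j\<in>{0<..}. {c::nat \<Rightarrow> 'e. c j = 0})"
  proof (intro set_eqI iffI)
    fix c :: "nat \<Rightarrow> 'e" assume "c \<in> (\<Inter>j\<in>{0<..}. {c. c j = 0})"
    then have "c = base (c 0)" by (auto simp: base_def fun_eq_iff)
    then show "c \<in> range base" by blast
  qed (auto simp: base_def)
  have "closed (range base :: (nat \<Rightarrow> 'e) set)"
    unfolding eq by (intro closed_INT ballI closed_Collect_eq continuous_on_product_coordinates continuous_on_const)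
  moreover have "subspace (range base :: (nat \<Rightarrow> 'e) set)"
    unfolding eq by (auto simp: subspace_def)
  ultimately show ?case by (simp add: closed_sub_def)
qed (simp add: closed_sub_Tset)

lemma overlap_subset_diag: "overlap M r \<alpha> \<beta> \<subseteq> overlap M r \<alpha> \<alpha>"
  by (induction r) (auto simp: Tset_iff)

lemma in_tpt: "(\<beta>, d) \<in> tpt M r \<alpha> c \<longleftrightarrow> \<beta> \<in> Idx M \<and> c \<in> overlap M r \<alpha> \<beta> \<and> d = trans_map M r \<alpha> \<beta> c"
  by (auto simp: tpt_def)

lemma coord_tpt: "c \<in> overlap M r \<alpha> \<beta> \<Longrightarrow> \<beta> \<in> Idx M \<Longrightarrow> coord (tpt M r \<alpha> c) \<beta> = trans_map M r \<alpha> \<beta> c"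
  by (auto simp: coord_def in_tpt)

text \<open>Overlaps at the next level restrict only the base point once the vector lies in the
  model space, so projecting loses and gains no charts.\<close>

lemma proj_tpt:
  assumes "c \<in> overlap M (Suc r) \<alpha> \<alpha>"
  shows "proj (tpt M (Suc r) \<alpha> c) = tpt M r \<alpha> (vfst c)"
  using assms by (fastforce simp: proj_def tpt_def Tset_iff Tmap_def)

lemma tpt_in_TM: "\<alpha> \<in> Idx M \<Longrightarrow> c \<in> overlap M r \<alpha> \<alpha> \<Longrightarrow> tpt M r \<alpha> c \<in> TM M r"
  by (auto simp: TM_def)

lemma TM_E:
  assumes "\<xi> \<in> TM M r"
  obtains \<alpha> c where "\<alpha> \<in> Idx M" "c \<in> overlap M r \<alpha> \<alpha>" "\<xi> = tpt M r \<alpha> c"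
  using assms by (auto simp: TM_def)

lemma swap_mid_vpair [simp]:
  "swap_mid (vpair (vpair x y) (vpair z w)) = vpair (vpair x z) (vpair y w)"
  by (simp add: swap_mid_def)

lemma swap_mid_overlap:
  "c \<in> Tset (Tset X X) (Tset X U) \<Longrightarrow> swap_mid c \<in> Tset (Tset X X) (Tset X U)"
  by (auto simp: swap_mid_def Tset_iff)

lemma swap_mid_swap_mid [simp]: "swap_mid (swap_mid c) = c"
  by (simp add: swap_mid_def)

locale banach_atlas =
  fixes M :: "('m, 'i, 'e::banach) atlas"
  assumes mfd: "banach_manifold M"
begin

lemma relopen_overlap:
  assumes "\<alpha> \<in> Idx M" "\<beta> \<in> Idx M"
  shows "relopen (model r) (overlap M r \<alpha> \<beta>)"
proof (induction r)
  case 0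
  let ?A = "Cht M \<alpha> ` (Dom M \<alpha> \<inter> Dom M \<beta>)"
  have "open ?A" using mfd assms by (auto simp: banach_manifold_def)
  then have "open ((\<lambda>c::nat \<Rightarrow> 'e. c 0) -` ?A)"
    by (rule open_vimage) (rule continuous_on_product_coordinates)
  moreover have "base ` ?A = range base \<inter> ((\<lambda>c::nat \<Rightarrow> 'e. c 0) -` ?A)"
    by (auto simp: base_def)
  ultimately show ?case using closed_sub_model[of 0] by (auto simp: relopen_def)
qed (simp add: relopen_Tset)

lemma C_diff_trans_map:
  assumes "\<alpha> \<in> Idx M" "\<beta> \<in> Idx M"
  shows "C_diff k (model r) (overlap M r \<alpha> \<beta>) (trans_map M r \<alpha> \<beta>)"
proof (induction r arbitrary: k)
  case 0
  then show ?case using mfd assms unfolding banach_manifold_def smooth_def by blast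
next
  case (Suc r)
  from Suc[of "Suc k"] show ?case by simp
qed

text \<open>At level 0 this comes from injectivity of charts. Higher up, the identity at level r
  holds on a relatively open triple overlap, and taking tangent maps of both sides gives the next
  level.\<close>

lemma trans_map_cocycle:
  assumes I: "\<alpha> \<in> Idx M" "\<beta> \<in> Idx M" "\<gamma> \<in> Idx M"
    and c: "c \<in> overlap M r \<alpha> \<beta>" "c \<in> overlap M r \<alpha> \<gamma>"
  shows "trans_map M r \<alpha> \<beta> c \<in> overlap M r \<beta> \<gamma>"
    and "trans_map M r \<beta> \<gamma> (trans_map M r \<alpha> \<beta> c) = trans_map M r \<alpha> \<gamma> c"
proof -
  have "trans_map M r \<alpha> \<beta> c \<in> overlap M r \<beta> \<gamma> \<and>
      trans_map M r \<beta> \<gamma> (trans_map M r \<alpha> \<beta> c) = trans_map M r \<alpha> \<gamma> c"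
    using c
  proof (induction r arbitrary: c)
    case 0
    have inj: "inj_on (Cht M \<delta>) (Dom M \<delta>)" if "\<delta> \<in> Idx M" for \<delta>
      using mfd that by (auto simp: banach_manifold_def)
    have Upt: "Upt M \<delta> (base (Cht M \<delta> p)) = p" if "\<delta> \<in> Idx M" "p \<in> Dom M \<delta>" for \<delta> p
      using inj that by (simp add: Upt_def base_def inv_into_f_f)
    obtain p where p: "p \<in> Dom M \<alpha>" "p \<in> Dom M \<beta>" "c = base (Cht M \<alpha> p)"
      using 0 by auto
    have "p \<in> Dom M \<gamma>"
    proof -
      \<comment> \<open>The two overlaps might provide different points for c; injectivity of the
        chart identifies them.\<close>
      obtain q where q: "q \<in> Dom M \<alpha>" "q \<in> Dom M \<gamma>" "c = base (Cht M \<alpha> q)"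
        using 0 by auto
      then show ?thesis using p I(1) Upt by metis
    qed
    then show ?case using p I by (auto simp: Upt)
  next
    case (Suc r)
    let ?W = "overlap M r \<alpha> \<beta> \<inter> overlap M r \<alpha> \<gamma>"
    have W: "relopen (model r) ?W" using I by (intro relopen_Int relopen_overlap)
    have f: "C_diff 1 (model r) ?W (trans_map M r \<alpha> \<beta>)"
      using C_diff_trans_map[OF I(1,2)] by (rule C_diff_subset) auto
    have cW: "c \<in> Tset (model r) ?W" using Suc.prems by (auto simp: Tset_iff)
    have im: "trans_map M r \<alpha> \<beta> ` ?W \<subseteq> overlap M r \<beta> \<gamma>" using Suc.IH by auto
    note T = Tmap_compose[OF W f relopen_overlap[OF I(2,3)] C_diff_trans_map[OF I(2,3)] im cW]
    have "Tmap (\<lambda>c. trans_map M r \<beta> \<gamma> (trans_map M r \<alpha> \<beta> c)) c = Tmap (trans_map M r \<alpha> \<gamma>) c"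
      using W cW by (rule Tmap_cong) (use Suc.IH in auto)
    with T(1,2) show ?case by simp
  qed
  then show "trans_map M r \<alpha> \<beta> c \<in> overlap M r \<beta> \<gamma>"
    and "trans_map M r \<beta> \<gamma> (trans_map M r \<alpha> \<beta> c) = trans_map M r \<alpha> \<gamma> c" by auto
qed

lemma trans_map_self:
  assumes I: "\<alpha> \<in> Idx M" and c: "c \<in> overlap M r \<alpha> \<alpha>"
  shows "trans_map M r \<alpha> \<alpha> c = c"
  using c
proof (induction r arbitrary: c)
  case 0
  have "inj_on (Cht M \<alpha>) (Dom M \<alpha>)" using mfd I by (auto simp: banach_manifold_def)
  with 0 show ?case by (auto simp: Upt_def base_def inv_into_f_f)
next
  case (Suc r)
  have "Tmap (trans_map M r \<alpha> \<alpha>) c = Tmap (\<lambda>x. x) c"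
    using relopen_overlap[OF I I] by (rule Tmap_cong) (use Suc in auto)
  then show ?case by (simp add: Tmap_linear[OF cont_linear_id])
qed

text \<open>Equality of the two classes needs the same charts on both sides; the reverse inclusion
  comes from the inverse coordinate change.\<close>

lemma tpt_change_chart:
  assumes I: "\<alpha> \<in> Idx M" "\<beta> \<in> Idx M" and c: "c \<in> overlap M r \<alpha> \<beta>"
  shows "tpt M r \<beta> (trans_map M r \<alpha> \<beta> c) = tpt M r \<alpha> c"
proof -
  let ?d = "trans_map M r \<alpha> \<beta> c"
  have c': "c \<in> overlap M r \<alpha> \<alpha>" by (rule subsetD[OF overlap_subset_diag c])
  have d: "?d \<in> overlap M r \<beta> \<alpha>" and dc: "trans_map M r \<beta> \<alpha> ?d = c"
    using trans_map_cocycle[OF I I(1) c c'] trans_map_self[OF I(1) c'] by auto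
  have "?d \<in> overlap M r \<beta> \<gamma> \<longleftrightarrow> c \<in> overlap M r \<alpha> \<gamma>" if "\<gamma> \<in> Idx M" for \<gamma>
    using trans_map_cocycle(1)[OF I that c] trans_map_cocycle(1)[OF I(2,1) that d] dc by auto
  then show ?thesis
    using trans_map_cocycle(2)[OF I _ c] by (auto simp: tpt_def)
qed

lemma coord_tpt_self: "\<alpha> \<in> Idx M \<Longrightarrow> c \<in> overlap M r \<alpha> \<alpha> \<Longrightarrow> coord (tpt M r \<alpha> c) \<alpha> = c"
  by (simp add: coord_tpt trans_map_self)

lemma tpt_inj:
  assumes "\<alpha> \<in> Idx M" "c \<in> overlap M r \<alpha> \<alpha>" "d \<in> overlap M r \<alpha> \<alpha>" "tpt M r \<alpha> c = tpt M r \<alpha> d"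
  shows "c = d"
  using assms coord_tpt_self by metis

section \<open>Maps with local representatives\<close>

text \<open>
  The last condition says that \<open>F \<alpha> c\<close> lies over the same charts as \<open>c\<close>; without it the
  tangent map, which looks at all charts around the image, could not be read off from \<open>F\<close>.
\<close>

definition represents ::
    "nat \<Rightarrow> nat \<Rightarrow> (('i, 'e) tpoint \<Rightarrow> ('i, 'e) tpoint) \<Rightarrow> ('i \<Rightarrow> (nat \<Rightarrow> 'e) \<Rightarrow> (nat \<Rightarrow> 'e)) \<Rightarrow> bool" where
  "represents r s f F \<longleftrightarrow> (\<forall>\<alpha>\<in>Idx M. \<forall>c\<in>overlap M r \<alpha> \<alpha>.
     F \<alpha> c \<in> overlap M s \<alpha> \<alpha> \<and> f (tpt M r \<alpha> c) = tpt M s \<alpha> (F \<alpha> c) \<and>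
     (\<forall>\<beta>\<in>Idx M. F \<alpha> c \<in> overlap M s \<alpha> \<beta> \<longleftrightarrow> c \<in> overlap M r \<alpha> \<beta>))"

lemma representsD:
  assumes "represents r s f F" "\<alpha> \<in> Idx M" "c \<in> overlap M r \<alpha> \<alpha>"
  shows "F \<alpha> c \<in> overlap M s \<alpha> \<alpha>" "f (tpt M r \<alpha> c) = tpt M s \<alpha> (F \<alpha> c)"
    "\<beta> \<in> Idx M \<Longrightarrow> F \<alpha> c \<in> overlap M s \<alpha> \<beta> \<longleftrightarrow> c \<in> overlap M r \<alpha> \<beta>"
  using assms by (auto simp: represents_def)

lemma represents_compose:
  "represents r s f F \<Longrightarrow> represents s t g G \<Longrightarrow> represents r t (g \<circ> f) (\<lambda>\<alpha> c. G \<alpha> (F \<alpha> c))"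
  by (simp add: represents_def)

lemma represents_unique:
  assumes "represents r s f F" "represents r s f G" "\<alpha> \<in> Idx M" "c \<in> overlap M r \<alpha> \<alpha>"
  shows "F \<alpha> c = G \<alpha> c"
  using representsD[OF assms(1,3,4)] representsD[OF assms(2,3,4)] tpt_inj[OF assms(3)] by metis

lemma loc_rep_represents:
  assumes "represents r s f F" "\<alpha> \<in> Idx M" "\<beta> \<in> Idx M" "c \<in> overlap M r \<alpha> \<beta>"
  shows "loc_rep M r f \<alpha> \<beta> c = trans_map M s \<alpha> \<beta> (F \<alpha> c)"
proof -
  have c: "c \<in> overlap M r \<alpha> \<alpha>" by (rule subsetD[OF overlap_subset_diag assms(4)])
  from representsD[OF assms(1,2) c] assms show ?thesis
    by (simp add: loc_rep_def coord_tpt)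
qed

lemma loc_rep_represents_self:
  assumes "represents r s f F" "\<alpha> \<in> Idx M" "c \<in> overlap M r \<alpha> \<alpha>"
  shows "loc_rep M r f \<alpha> \<alpha> c = F \<alpha> c"
  using loc_rep_represents[OF assms(1,2,2,3)] representsD(1)[OF assms] trans_map_self[OF assms(2)] by simp

text \<open>Both sides are the \<beta>-coordinates of one and the same image point.\<close>

lemma represents_trans_map:
  assumes f: "represents r s f F" and I: "\<alpha> \<in> Idx M" "\<beta> \<in> Idx M" and c: "c \<in> overlap M r \<alpha> \<beta>"
  shows "F \<beta> (trans_map M r \<alpha> \<beta> c) = trans_map M s \<alpha> \<beta> (F \<alpha> c)"
proof -
  let ?d = "trans_map M r \<alpha> \<beta> c"
  have c': "c \<in> overlap M r \<alpha> \<alpha>" by (rule subsetD[OF overlap_subset_diag c])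
  have d: "?d \<in> overlap M r \<beta> \<beta>" by (rule trans_map_cocycle[OF I I(2) c c])
  have "tpt M s \<beta> (F \<beta> ?d) = tpt M s \<alpha> (F \<alpha> c)"
    using representsD(2)[OF f I(2) d] representsD(2)[OF f I(1) c'] tpt_change_chart[OF I c] by simp
  moreover have "coord (tpt M s \<beta> (F \<beta> ?d)) \<beta> = F \<beta> ?d"
    by (rule coord_tpt_self[OF I(2) representsD(1)[OF f I(2) d]])
  moreover have "F \<alpha> c \<in> overlap M s \<alpha> \<beta>"
    using representsD(3)[OF f I(1) c' I(2)] c by simp
  ultimately show ?thesis using coord_tpt I(2) by metis
qed

lemma Tmap_trans_map_compose:
  assumes f: "represents r s f F" and I: "\<alpha> \<in> Idx M" "\<beta> \<in> Idx M"
    and F: "C_diff 1 (model r) (overlap M r \<alpha> \<alpha>) (F \<alpha>)" and c: "c \<in> overlap M (Suc r) \<alpha> \<beta>"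
  shows "Tmap (F \<alpha>) c \<in> overlap M (Suc s) \<alpha> \<beta>"
    and "Tmap (\<lambda>x. trans_map M s \<alpha> \<beta> (F \<alpha> x)) c = trans_map M (Suc s) \<alpha> \<beta> (Tmap (F \<alpha>) c)"
proof -
  have "C_diff 1 (model r) (overlap M r \<alpha> \<beta>) (F \<alpha>)"
    using F overlap_subset_diag by (rule C_diff_subset)
  moreover have "F \<alpha> ` overlap M r \<alpha> \<beta> \<subseteq> overlap M s \<alpha> \<beta>"
    using f I overlap_subset_diag[of M r \<alpha> \<beta>] by (auto simp: represents_def)
  ultimately show "Tmap (F \<alpha>) c \<in> overlap M (Suc s) \<alpha> \<beta>"
    and "Tmap (\<lambda>x. trans_map M s \<alpha> \<beta> (F \<alpha> x)) c = trans_map M (Suc s) \<alpha> \<beta> (Tmap (F \<alpha>) c)"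
    using Tmap_compose[OF relopen_overlap[OF I] _ relopen_overlap[OF I] C_diff_trans_map[OF I]] c
    by simp_all
qed

text \<open>A vector of \<open>Dmap\<close> is computed from some chart \<gamma> around the point
  and read in some chart \<beta> around the image. Compatibility of F with coordinate changes, the
  chain rule and the cocycle identity show that the choice of \<gamma> does not matter.\<close>

lemma represents_Dmap:
  assumes f: "represents r s f F"
    and F: "\<And>\<alpha>. \<alpha> \<in> Idx M \<Longrightarrow> C_diff 1 (model r) (overlap M r \<alpha> \<alpha>) (F \<alpha>)"
  shows "represents (Suc r) (Suc s) (Dmap M r f) (\<lambda>\<alpha>. Tmap (F \<alpha>))"
  unfolding represents_def
proof (intro ballI conjI)
  fix \<alpha> c assume \<alpha>: "\<alpha> \<in> Idx M" and c: "c \<in> overlap M (Suc r) \<alpha> \<alpha>"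
  have c1: "vfst c \<in> overlap M r \<alpha> \<alpha>" and c2: "vsnd c \<in> model r" using c by (auto simp: Tset_iff)
  show Tc: "Tmap (F \<alpha>) c \<in> overlap M (Suc s) \<alpha> \<alpha>"
    by (rule Tmap_trans_map_compose[OF f \<alpha> \<alpha> F[OF \<alpha>] c])
  show iff: "Tmap (F \<alpha>) c \<in> overlap M (Suc s) \<alpha> \<beta> \<longleftrightarrow> c \<in> overlap M (Suc r) \<alpha> \<beta>" if "\<beta> \<in> Idx M" for \<beta>
    using Tc representsD(3)[OF f \<alpha> c1 that] c2 by (auto simp: Tset_iff Tmap_def)
  have key: "Tmap (loc_rep M r f \<gamma> \<beta>) (trans_map M (Suc r) \<alpha> \<gamma> c) = trans_map M (Suc s) \<alpha> \<beta> (Tmap (F \<alpha>) c)"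
    if I: "\<beta> \<in> Idx M" "\<gamma> \<in> Idx M" and cb: "c \<in> overlap M (Suc r) \<alpha> \<beta>" and cg: "c \<in> overlap M (Suc r) \<alpha> \<gamma>"
    for \<beta> \<gamma>
  proof -
    let ?c = "trans_map M (Suc r) \<alpha> \<gamma> c"
    have c': "?c \<in> overlap M (Suc r) \<gamma> \<beta>" by (rule trans_map_cocycle[OF \<alpha> I(2,1) cg cb])
    have "Tmap (loc_rep M r f \<gamma> \<beta>) ?c = Tmap (\<lambda>x. trans_map M s \<gamma> \<beta> (F \<gamma> x)) ?c"
      using relopen_overlap[OF I(2,1)] by (rule Tmap_cong)
        (use c' loc_rep_represents[OF f I(2,1)] in auto)
    also have "\<dots> = trans_map M (Suc s) \<gamma> \<beta> (Tmap (F \<gamma>) ?c)"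
      by (rule Tmap_trans_map_compose[OF f I(2,1) F[OF I(2)] c'])
    also have "Tmap (F \<gamma>) ?c = Tmap (\<lambda>x. F \<gamma> (trans_map M r \<alpha> \<gamma> x)) c"
    proof -
      have "trans_map M r \<alpha> \<gamma> ` overlap M r \<alpha> \<gamma> \<subseteq> overlap M r \<gamma> \<gamma>"
        using trans_map_cocycle(1)[OF \<alpha> I(2) I(2)] by blast
      then show ?thesis
        using Tmap_compose(2)[OF relopen_overlap[OF \<alpha> I(2)] C_diff_trans_map[OF \<alpha> I(2)]
            relopen_overlap[OF I(2,2)] F[OF I(2)]] cg by simp
    qed
    also have "\<dots> = Tmap (\<lambda>x. trans_map M s \<alpha> \<gamma> (F \<alpha> x)) c"
      using relopen_overlap[OF \<alpha> I(2)] by (rule Tmap_cong)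
        (use cg represents_trans_map[OF f \<alpha> I(2)] in auto)
    also have "\<dots> = trans_map M (Suc s) \<alpha> \<gamma> (Tmap (F \<alpha>) c)"
      by (rule Tmap_trans_map_compose[OF f \<alpha> I(2) F[OF \<alpha>] cg])
    also have "trans_map M (Suc s) \<gamma> \<beta> \<dots> = trans_map M (Suc s) \<alpha> \<beta> (Tmap (F \<alpha>) c)"
      using cb cg iff I by (intro trans_map_cocycle(2)[OF \<alpha> I(2,1)]) blast+
    finally show ?thesis .
  qed
  \<comment> \<open>The charts around the image of the base point are exactly those around the point
    itself; this is the use of the last condition of \<open>represents\<close>.\<close>
  have dom: "(\<exists>b. (\<beta>, b) \<in> f (proj (tpt M (Suc r) \<alpha> c))) \<longleftrightarrow> \<beta> \<in> Idx M \<and> c \<in> overlap M (Suc r) \<alpha> \<beta>" for \<beta>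
    using representsD(2,3)[OF f \<alpha> c1] c2 unfolding proj_tpt[OF c] by (auto simp: in_tpt Tset_iff)
  show "Dmap M r f (tpt M (Suc r) \<alpha> c) = tpt M (Suc s) \<alpha> (Tmap (F \<alpha>) c)"
  proof (intro set_eqI, clarify)
    fix \<beta> d
    have "(\<beta>, d) \<in> Dmap M r f (tpt M (Suc r) \<alpha> c) \<longleftrightarrow> (\<exists>\<gamma> e. (\<gamma>, e) \<in> tpt M (Suc r) \<alpha> c \<and>
        d = Tmap (loc_rep M r f \<gamma> \<beta>) e \<and> \<beta> \<in> Idx M \<and> c \<in> overlap M (Suc r) \<alpha> \<beta>)"
      unfolding Dmap_def dom by auto
    also have "\<dots> \<longleftrightarrow> \<beta> \<in> Idx M \<and> c \<in> overlap M (Suc r) \<alpha> \<beta> \<and>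
        d = trans_map M (Suc s) \<alpha> \<beta> (Tmap (F \<alpha>) c)"
    proof (intro iffI)
      assume "\<exists>\<gamma> e. (\<gamma>, e) \<in> tpt M (Suc r) \<alpha> c \<and>
        d = Tmap (loc_rep M r f \<gamma> \<beta>) e \<and> \<beta> \<in> Idx M \<and> c \<in> overlap M (Suc r) \<alpha> \<beta>"
      then show "\<beta> \<in> Idx M \<and> c \<in> overlap M (Suc r) \<alpha> \<beta> \<and> d = trans_map M (Suc s) \<alpha> \<beta> (Tmap (F \<alpha>) c)"
        unfolding in_tpt using key by blast
    next
      assume "\<beta> \<in> Idx M \<and> c \<in> overlap M (Suc r) \<alpha> \<beta> \<and> d = trans_map M (Suc s) \<alpha> \<beta> (Tmap (F \<alpha>) c)"
      then show "\<exists>\<gamma> e. (\<gamma>, e) \<in> tpt M (Suc r) \<alpha> c \<and>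
        d = Tmap (loc_rep M r f \<gamma> \<beta>) e \<and> \<beta> \<in> Idx M \<and> c \<in> overlap M (Suc r) \<alpha> \<beta>"
        using key[of \<beta> \<alpha>] \<alpha> c unfolding in_tpt by metis
    qed
    also have "\<dots> \<longleftrightarrow> (\<beta>, d) \<in> tpt M (Suc s) \<alpha> (Tmap (F \<alpha>) c)"
      unfolding in_tpt using iff by blast
    finally show "(\<beta>, d) \<in> Dmap M r f (tpt M (Suc r) \<alpha> c) \<longleftrightarrow> (\<beta>, d) \<in> tpt M (Suc s) \<alpha> (Tmap (F \<alpha>) c)" .
  qed
qed

lemma represents_proj: "represents (Suc r) r proj (\<lambda>_. vfst)"
  unfolding represents_def by (auto simp: proj_tpt simp del: overlap.simps) (auto simp: Tset_iff)

text \<open>At level r + 2 coordinate changes are second tangent maps, so they commute with the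
  flip, and flipping every representative of a class gives a class.\<close>

lemma represents_kappa: "represents (Suc (Suc r)) (Suc (Suc r)) (kappa (Suc (Suc r))) (\<lambda>_. swap_mid)"
  unfolding represents_def
proof (intro ballI conjI)
  fix \<alpha> c assume \<alpha>: "\<alpha> \<in> Idx M" and c: "c \<in> overlap M (Suc (Suc r)) \<alpha> \<alpha>"
  show "swap_mid c \<in> overlap M (Suc (Suc r)) \<alpha> \<alpha>" using c swap_mid_overlap by simp
  show iff: "swap_mid c \<in> overlap M (Suc (Suc r)) \<alpha> \<beta> \<longleftrightarrow> c \<in> overlap M (Suc (Suc r)) \<alpha> \<beta>" for \<beta>
    by (simp, metis swap_mid_overlap swap_mid_swap_mid)
  have sw: "trans_map M (Suc (Suc r)) \<alpha> \<beta> (swap_mid c) = swap_mid (trans_map M (Suc (Suc r)) \<alpha> \<beta> c)"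
    if "\<beta> \<in> Idx M" "c \<in> overlap M (Suc (Suc r)) \<alpha> \<beta>" for \<beta>
    using Tmap_Tmap_swap_mid[OF relopen_overlap[OF \<alpha> that(1)] C_diff_trans_map[OF \<alpha> that(1)]] that(2)
    by simp
  show "kappa (Suc (Suc r)) (tpt M (Suc (Suc r)) \<alpha> c) = tpt M (Suc (Suc r)) \<alpha> (swap_mid c)"
    unfolding kappa_def tpt_def iff using sw by (auto simp del: overlap.simps trans_map.simps)
qed

text \<open>A value of \<open>S\<close> is first known only in some chart \<beta>. Its base point is
  the argument, which lies in \<alpha>, so the value can be moved to \<alpha>.\<close>

lemma represents_vector_field:
  assumes S: "vector_field M r S"
  shows "represents r (Suc r) S (\<lambda>\<alpha>. loc_rep M r S \<alpha> \<alpha>)"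
    and "\<alpha> \<in> Idx M \<Longrightarrow> c \<in> overlap M r \<alpha> \<alpha> \<Longrightarrow> vfst (loc_rep M r S \<alpha> \<alpha> c) = c"
proof -
  have *: "vfst (loc_rep M r S \<alpha> \<alpha> c) = c \<and> loc_rep M r S \<alpha> \<alpha> c \<in> overlap M (Suc r) \<alpha> \<alpha> \<and>
      S (tpt M r \<alpha> c) = tpt M (Suc r) \<alpha> (loc_rep M r S \<alpha> \<alpha> c)"
    if \<alpha>: "\<alpha> \<in> Idx M" and c: "c \<in> overlap M r \<alpha> \<alpha>" for \<alpha> c
  proof -
    have "S (tpt M r \<alpha> c) \<in> TM M (Suc r)" and p: "proj (S (tpt M r \<alpha> c)) = tpt M r \<alpha> c"
      using S tpt_in_TM[OF \<alpha> c] by (auto simp: vector_field_def)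
    then obtain \<beta> d where \<beta>: "\<beta> \<in> Idx M" and d: "d \<in> overlap M (Suc r) \<beta> \<beta>"
      and Sc: "S (tpt M r \<alpha> c) = tpt M (Suc r) \<beta> d" by (elim TM_E)
    have pd: "tpt M r \<beta> (vfst d) = tpt M r \<alpha> c" using p Sc proj_tpt[OF d] by simp
    have "(\<alpha>, c) \<in> tpt M r \<alpha> c" using \<alpha> c by (simp add: in_tpt trans_map_self)
    then have "vfst d \<in> overlap M r \<beta> \<alpha>" by (simp add: pd[symmetric] in_tpt)
    then have d': "d \<in> overlap M (Suc r) \<beta> \<alpha>" using d by (simp add: Tset_iff)
    let ?e = "trans_map M (Suc r) \<beta> \<alpha> d"
    have e: "?e \<in> overlap M (Suc r) \<alpha> \<alpha>" by (rule trans_map_cocycle[OF \<beta> \<alpha> \<alpha> d' d'])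
    have Se: "S (tpt M r \<alpha> c) = tpt M (Suc r) \<alpha> ?e" using tpt_change_chart[OF \<beta> \<alpha> d'] Sc by simp
    have L: "loc_rep M r S \<alpha> \<alpha> c = ?e" unfolding loc_rep_def Se by (rule coord_tpt_self[OF \<alpha> e])
    have e1: "vfst ?e \<in> overlap M r \<alpha> \<alpha>" using e by (simp add: Tset_iff)
    have "tpt M r \<alpha> (vfst ?e) = tpt M r \<alpha> c" using p Se proj_tpt[OF e] by simp
    then have "vfst ?e = c" by (rule tpt_inj[OF \<alpha> e1 c])
    with e Se L show ?thesis by simp
  qed
  then show "\<alpha> \<in> Idx M \<Longrightarrow> c \<in> overlap M r \<alpha> \<alpha> \<Longrightarrow> vfst (loc_rep M r S \<alpha> \<alpha> c) = c" by blast
  show "represents r (Suc r) S (\<lambda>\<alpha>. loc_rep M r S \<alpha> \<alpha>)"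
    unfolding represents_def using * by (auto simp: Tset_iff)
qed

lemma vector_fieldI:
  assumes f: "represents r (Suc r) f F"
    and v: "\<And>\<alpha> c. \<alpha> \<in> Idx M \<Longrightarrow> c \<in> overlap M r \<alpha> \<alpha> \<Longrightarrow> vfst (F \<alpha> c) = c"
    and F: "\<And>\<alpha> k. \<alpha> \<in> Idx M \<Longrightarrow> C_diff k (model r) (overlap M r \<alpha> \<alpha>) (F \<alpha>)"
  shows "vector_field M r f"
  unfolding vector_field_def smooth_def
proof (intro conjI ballI allI)
  fix \<xi> assume "\<xi> \<in> TM M r"
  then obtain \<alpha> c where *: "\<alpha> \<in> Idx M" "c \<in> overlap M r \<alpha> \<alpha>" "\<xi> = tpt M r \<alpha> c" by (rule TM_E)
  from representsD(1,2)[OF f *(1,2)] * show "f \<xi> \<in> TM M (Suc r)" "proj (f \<xi>) = \<xi>"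
    using tpt_in_TM v by (auto simp: proj_tpt simp del: overlap.simps)
next
  fix \<alpha> k assume \<alpha>: "\<alpha> \<in> Idx M"
  show "C_diff k (model r) (overlap M r \<alpha> \<alpha>) (loc_rep M r f \<alpha> \<alpha>)"
    using relopen_overlap[OF \<alpha> \<alpha>] _ F[OF \<alpha>]
    by (rule C_diff_cong) (simp add: loc_rep_represents_self[OF f \<alpha>])
qed

end

section \<open>Sprays in charts\<close>

text \<open>The four factors of the complete lift in one chart. The flip has the same formula at
  both levels, and its tangent map stands for D\<kappa>.\<close>

definition clift_loc :: "((nat \<Rightarrow> 'a::real_normed_vector) \<Rightarrow> nat \<Rightarrow> 'a) \<Rightarrow> (nat \<Rightarrow> 'a) \<Rightarrow> nat \<Rightarrow> 'a" where
  "clift_loc F c = Tmap swap_mid (swap_mid (Tmap F (swap_mid c)))"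

lemma has_dir_deriv_vpair:
  "has_dir_deriv f x v d \<longleftrightarrow>
    has_dir_deriv (\<lambda>x. vfst (f x)) x v (vfst d) \<and> has_dir_deriv (\<lambda>x. vsnd (f x)) x v (vsnd d)"
  unfolding has_dir_deriv_def by (subst tendsto_vpair_iff) simp

text \<open>The argument is flipped to ((x, z), (y, w)), and \<open>Tmap F\<close> yields (((x, z),
  (z, K)), ((y, w), (w, dK))). The outer flip gives (((x, z), (y, w)), ((z, K), (w, dK))), and the
  tangent map of the flip rearranges each half. Differentiability of \<open>K\<close> is extracted
  from that of \<open>F\<close>, of which it is a component.\<close>

lemma clift_loc_semispray:
  fixes F :: "(nat \<Rightarrow> 'a::real_normed_vector) \<Rightarrow> nat \<Rightarrow> 'a"
  assumes U: "relopen X U" and F: "C_diff 1 X U F"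
    and eq: "\<And>q. q \<in> U \<Longrightarrow> F q = vpair q (vpair (vsnd q) (K q))"
    and p: "vpair x z \<in> U" and v: "vpair y w \<in> X"
  shows "has_dir_deriv K (vpair x z) (vpair y w) (dir_deriv K (vpair x z) (vpair y w))"
    and "clift_loc F (vpair (vpair x y) (vpair z w)) = vpair (vpair (vpair x y) (vpair z w))
      (vpair (vpair z w) (vpair (K (vpair x z)) (dir_deriv K (vpair x z) (vpair y w))))"
proof -
  let ?p = "vpair x z" and ?v = "vpair y w"
  let ?d = "dir_deriv F ?p ?v"
  have "has_dir_deriv F ?p ?v ?d"
    using F p v by (intro C_diff_has_dir_deriv[of 0]) auto
  then have "has_dir_deriv (\<lambda>q. vpair q (vpair (vsnd q) (K q))) ?p ?v ?d"
    using has_dir_deriv_cong[OF U p v eq] by simp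
  then have "has_dir_deriv (\<lambda>q. q) ?p ?v (vfst ?d)"
    and "has_dir_deriv (\<lambda>q. vpair (vsnd q) (K q)) ?p ?v (vsnd ?d)"
    using has_dir_deriv_vpair[of "\<lambda>q. vpair q (vpair (vsnd q) (K q))"] by simp_all
  then have d: "has_dir_deriv (\<lambda>q. q) ?p ?v (vfst ?d)" "has_dir_deriv vsnd ?p ?v (vfst (vsnd ?d))"
    "has_dir_deriv K ?p ?v (vsnd (vsnd ?d))"
    using has_dir_deriv_vpair[of "\<lambda>q. vpair (vsnd q) (K q)"] by simp_all
  have K: "dir_deriv K ?p ?v = vsnd (vsnd ?d)" using d(3) by (rule dir_deriv_eqI)
  then show "has_dir_deriv K ?p ?v (dir_deriv K ?p ?v)" using d(3) by simp
  have "vfst ?d = ?v"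
    using d(1) has_dir_deriv_linear[of "\<lambda>q. q" ?p ?v] cont_linear_id
    by (auto intro: has_dir_deriv_unique simp: cont_linear_def)
  moreover have "vfst (vsnd ?d) = w"
    using has_dir_deriv_unique[OF d(2) has_dir_deriv_linear[OF conjunct1[OF
          cont_linear_vsnd[unfolded cont_linear_def]]]] by simp
  ultimately have "?d = vpair ?v (vpair w (dir_deriv K ?p ?v))"
    unfolding K by (metis vpair_vfst_vsnd)
  then show "clift_loc F (vpair (vpair x y) (vpair z w)) = vpair (vpair (vpair x y) (vpair z w))
      (vpair (vpair z w) (vpair (K ?p) (dir_deriv K ?p ?v)))"
    unfolding clift_loc_def by (simp add: Tmap_linear[OF cont_linear_swap_mid])
      (simp add: Tmap_def eq[OF p])
qed

text \<open>The line from (x, s z) in the direction (y, s w) consists of the points (x + t y, s (z +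
  t w)), so its difference quotients are s^2 times the original ones; s = 0 is included.\<close>

lemma dir_deriv_homogeneous:
  fixes K :: "(nat \<Rightarrow> 'a::real_normed_vector) \<Rightarrow> nat \<Rightarrow> 'b::real_normed_vector"
  assumes U: "relopen Y V" and hom: "\<And>x z. x \<in> V \<Longrightarrow> z \<in> Y \<Longrightarrow> K (vpair x (s *\<^sub>R z)) = s\<^sup>2 *\<^sub>R K (vpair x z)"
    and K: "has_dir_deriv K (vpair x z) (vpair y w) d"
    and x: "x \<in> V" and z: "z \<in> Y" "y \<in> Y" "w \<in> Y"
  shows "has_dir_deriv K (vpair x (s *\<^sub>R z)) (vpair y (s *\<^sub>R w)) (s\<^sup>2 *\<^sub>R d)"
  unfolding has_dir_deriv_def
proof (rule Lim_transform_eventually)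
  show "((\<lambda>t. s\<^sup>2 *\<^sub>R ((K (vpair x z + t *\<^sub>R vpair y w) - K (vpair x z)) /\<^sub>R t)) \<longlongrightarrow> s\<^sup>2 *\<^sub>R d) (at 0)"
    unfolding tendsto_coordinatewise
  proof
    fix j
    show "((\<lambda>t. (s\<^sup>2 *\<^sub>R ((K (vpair x z + t *\<^sub>R vpair y w) - K (vpair x z)) /\<^sub>R t)) j) \<longlongrightarrow> (s\<^sup>2 *\<^sub>R d) j) (at 0)"
      unfolding scaleR_fun_apply[of "s\<^sup>2"]
      by (rule tendsto_scaleR[OF tendsto_const]) (use K in \<open>simp add: has_dir_deriv_def tendsto_coordinatewise\<close>)
  qed
  have Y: "closed_sub Y" using U by (rule relopenD)
  show "\<forall>\<^sub>F t in at 0. s\<^sup>2 *\<^sub>R ((K (vpair x z + t *\<^sub>R vpair y w) - K (vpair x z)) /\<^sub>R t) =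
     (K (vpair x (s *\<^sub>R z) + t *\<^sub>R vpair y (s *\<^sub>R w)) - K (vpair x (s *\<^sub>R z))) /\<^sub>R t"
    using eventually_line[OF U x z(2)]
  proof eventually_elim
    case (elim t)
    have "vpair x (s *\<^sub>R z) + t *\<^sub>R vpair y (s *\<^sub>R w) = vpair (x + t *\<^sub>R y) (s *\<^sub>R (z + t *\<^sub>R w))"
      by (simp add: vpair_plus vpair_scaleR algebra_simps)
    then have "K (vpair x (s *\<^sub>R z) + t *\<^sub>R vpair y (s *\<^sub>R w)) = s\<^sup>2 *\<^sub>R K (vpair x z + t *\<^sub>R vpair y w)"
      using hom[OF elim, of "z + t *\<^sub>R w"] z closed_subD[OF Y] by (simp add: vpair_plus vpair_scaleR)
    then show ?case by (simp add: hom[OF x z(1)] scaleR_diff_right mult.commute)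
  qed
qed

context banach_atlas
begin

section \<open>Sprays expressed by chart representatives\<close>

text \<open>A coordinate vector is fixed by the flip exactly when its two middle components agree;
  the section property turns one of them into \<open>vsnd c\<close>.\<close>

lemma semispray_iff:
  "semispray M i S \<longleftrightarrow> vector_field M (Suc i) S \<and>
    (\<forall>\<alpha>\<in>Idx M. \<forall>c\<in>overlap M (Suc i) \<alpha> \<alpha>. vfst (vsnd (loc_rep M (Suc i) S \<alpha> \<alpha> c)) = vsnd c)"
proof (cases "vector_field M (Suc i) S")
  case True
  note S = represents_vector_field[OF True]
  let ?F = "\<lambda>\<alpha>. loc_rep M (Suc i) S \<alpha> \<alpha>"
  have *: "kappa (i + 2) (S (tpt M (Suc i) \<alpha> c)) = S (tpt M (Suc i) \<alpha> c) \<longleftrightarrow>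
      vfst (vsnd (?F \<alpha> c)) = vsnd c" if \<alpha>: "\<alpha> \<in> Idx M" and c: "c \<in> overlap M (Suc i) \<alpha> \<alpha>" for \<alpha> c
  proof -
    note F = representsD[OF S(1) \<alpha> c] and k = representsD[OF represents_kappa \<alpha>]
    have "kappa (i + 2) (S (tpt M (Suc i) \<alpha> c)) = S (tpt M (Suc i) \<alpha> c) \<longleftrightarrow>
        tpt M (Suc (Suc i)) \<alpha> (swap_mid (?F \<alpha> c)) = tpt M (Suc (Suc i)) \<alpha> (?F \<alpha> c)"
      using k(2)[OF F(1)] F(2) by simp
    also have "\<dots> \<longleftrightarrow> swap_mid (?F \<alpha> c) = ?F \<alpha> c"
      using tpt_inj[OF \<alpha> k(1)[OF F(1)] F(1)] by auto
    also have "\<dots> \<longleftrightarrow> vfst (vsnd (?F \<alpha> c)) = vsnd (vfst (?F \<alpha> c))"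
      unfolding swap_mid_def by (metis vfst_vpair vsnd_vpair vpair_vfst_vsnd)
    finally show ?thesis using S(2)[OF \<alpha> c] by simp
  qed
  have "(\<forall>\<xi>\<in>TM M (Suc i). kappa (i + 2) (S \<xi>) = S \<xi>) \<longleftrightarrow>
    (\<forall>\<alpha>\<in>Idx M. \<forall>c\<in>overlap M (Suc i) \<alpha> \<alpha>. kappa (i + 2) (S (tpt M (Suc i) \<alpha> c)) = S (tpt M (Suc i) \<alpha> c))"
    unfolding TM_def by blast
  with True * show ?thesis unfolding semispray_def by auto
qed (simp add: semispray_def)

text \<open>A form of the spray conditions that \<open>clift_loc\<close> preserves. Homogeneity is
  stated for K = -2 G, which avoids the factor of \<open>spray_coeff\<close>.\<close>

definition spray_loc :: "nat \<Rightarrow> ('i \<Rightarrow> (nat \<Rightarrow> 'e) \<Rightarrow> nat \<Rightarrow> 'e) \<Rightarrow> bool" where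
  "spray_loc i F \<longleftrightarrow> (\<forall>\<alpha>\<in>Idx M. (\<forall>k. C_diff k (model (Suc i)) (overlap M (Suc i) \<alpha> \<alpha>) (F \<alpha>)) \<and>
    (\<forall>c\<in>overlap M (Suc i) \<alpha> \<alpha>. F \<alpha> c = vpair c (vpair (vsnd c) (vsnd (vsnd (F \<alpha> c))))) \<and>
    (\<forall>s. \<forall>x\<in>overlap M i \<alpha> \<alpha>. \<forall>y\<in>model i.
      vsnd (vsnd (F \<alpha> (vpair x (s *\<^sub>R y)))) = s\<^sup>2 *\<^sub>R vsnd (vsnd (F \<alpha> (vpair x y)))))"

lemma spray_coeff_hom_iff:
  "spray_coeff M i S \<alpha> x (s *\<^sub>R y) = s\<^sup>2 *\<^sub>R spray_coeff M i S \<alpha> x y \<longleftrightarrow>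
    vsnd (vsnd (loc_rep M (Suc i) S \<alpha> \<alpha> (vpair x (s *\<^sub>R y)))) =
      s\<^sup>2 *\<^sub>R vsnd (vsnd (loc_rep M (Suc i) S \<alpha> \<alpha> (vpair x y)))"
proof -
  have "spray_coeff M i S \<alpha> x (s *\<^sub>R y) = s\<^sup>2 *\<^sub>R spray_coeff M i S \<alpha> x y \<longleftrightarrow>
    (- 1 / 2) *\<^sub>R vsnd (vsnd (loc_rep M (Suc i) S \<alpha> \<alpha> (vpair x (s *\<^sub>R y)))) =
    (- 1 / 2) *\<^sub>R (s\<^sup>2 *\<^sub>R vsnd (vsnd (loc_rep M (Suc i) S \<alpha> \<alpha> (vpair x y))))"
    unfolding spray_coeff_def by (simp only: scaleR_left_commute)
  then show ?thesis by (simp only: scaleR_cancel_left) simp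
qed

lemma spray_imp_spray_loc:
  assumes "spray M i S"
  shows "represents (Suc i) (Suc (Suc i)) S (\<lambda>\<alpha>. loc_rep M (Suc i) S \<alpha> \<alpha>)"
    and "spray_loc i (\<lambda>\<alpha>. loc_rep M (Suc i) S \<alpha> \<alpha>)"
proof -
  have S: "vector_field M (Suc i) S" "\<And>\<alpha> c. \<alpha> \<in> Idx M \<Longrightarrow> c \<in> overlap M (Suc i) \<alpha> \<alpha> \<Longrightarrow>
      vfst (vsnd (loc_rep M (Suc i) S \<alpha> \<alpha> c)) = vsnd c"
    using assms semispray_iff by (auto simp: spray_def)
  show "represents (Suc i) (Suc (Suc i)) S (\<lambda>\<alpha>. loc_rep M (Suc i) S \<alpha> \<alpha>)"
    using S(1) by (rule represents_vector_field)
  have "loc_rep M (Suc i) S \<alpha> \<alpha> c = vpair c (vpair (vsnd c) (vsnd (vsnd (loc_rep M (Suc i) S \<alpha> \<alpha> c))))"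
    if "\<alpha> \<in> Idx M" "c \<in> overlap M (Suc i) \<alpha> \<alpha>" for \<alpha> c
    using S(2)[OF that] represents_vector_field(2)[OF S(1) that] by (metis vpair_vfst_vsnd)
  moreover have "C_diff k (model (Suc i)) (overlap M (Suc i) \<alpha> \<alpha>) (loc_rep M (Suc i) S \<alpha> \<alpha>)"
    if "\<alpha> \<in> Idx M" for \<alpha> k
    using S(1) that by (auto simp: vector_field_def smooth_def)
  ultimately show "spray_loc i (\<lambda>\<alpha>. loc_rep M (Suc i) S \<alpha> \<alpha>)"
    using assms unfolding spray_loc_def spray_def spray_coeff_hom_iff by blast
qed

lemma spray_loc_imp_spray:
  assumes S: "represents (Suc i) (Suc (Suc i)) S F" and F: "spray_loc i F"
  shows "spray M i S"
proof -
  have eq: "F \<alpha> c = vpair c (vpair (vsnd c) (vsnd (vsnd (F \<alpha> c))))"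
    if "\<alpha> \<in> Idx M" "c \<in> overlap M (Suc i) \<alpha> \<alpha>" for \<alpha> c
    using F that unfolding spray_loc_def by blast
  have V: "vector_field M (Suc i) S"
  proof (rule vector_fieldI[OF S])
    show "vfst (F \<alpha> c) = c" if "\<alpha> \<in> Idx M" "c \<in> overlap M (Suc i) \<alpha> \<alpha>" for \<alpha> c
      using eq[OF that] by (metis vfst_vpair)
  qed (use F in \<open>unfold spray_loc_def, blast\<close>)
  have L: "loc_rep M (Suc i) S \<alpha> \<alpha> c = F \<alpha> c" if "\<alpha> \<in> Idx M" "c \<in> overlap M (Suc i) \<alpha> \<alpha>" for \<alpha> c
    by (rule loc_rep_represents_self[OF S that])
  have "vfst (vsnd (F \<alpha> c)) = vsnd c" if "\<alpha> \<in> Idx M" "c \<in> overlap M (Suc i) \<alpha> \<alpha>" for \<alpha> c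
    using eq[OF that] by (metis vfst_vpair vsnd_vpair)
  then have "semispray M i S" unfolding semispray_iff using V L by simp
  moreover have "vsnd (vsnd (loc_rep M (Suc i) S \<alpha> \<alpha> (vpair x (s *\<^sub>R y)))) =
      s\<^sup>2 *\<^sub>R vsnd (vsnd (loc_rep M (Suc i) S \<alpha> \<alpha> (vpair x y)))"
    if \<alpha>: "\<alpha> \<in> Idx M" and x: "x \<in> overlap M i \<alpha> \<alpha>" and y: "y \<in> model i" for \<alpha> s x y
    using F \<alpha> x y L[OF \<alpha>, of "vpair x y"] L[OF \<alpha>, of "vpair x (s *\<^sub>R y)"]
      closed_subD(3)[OF closed_sub_model y, of s]
    by (simp add: spray_loc_def)
  ultimately show ?thesis unfolding spray_def spray_coeff_hom_iff by blast
qed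

section \<open>The complete lift of a spray\<close>

text \<open>A spray on the i-th bundle is a field one level higher, so both involutions in the lift
  have index at least 2 and are genuine flips.\<close>

lemma represents_clift:
  assumes S: "represents (Suc i) (Suc (Suc i)) S F" and F: "spray_loc i F"
  shows "represents (Suc (Suc i)) (Suc (Suc (Suc i))) (clift M (Suc i) S) (\<lambda>\<alpha>. clift_loc (F \<alpha>))"
proof -
  have "C_diff 1 (model (Suc i)) (overlap M (Suc i) \<alpha> \<alpha>) (F \<alpha>)" if "\<alpha> \<in> Idx M" for \<alpha>
    using F that unfolding spray_loc_def by blast
  note DS = represents_Dmap[OF S this]
  note Dk = represents_Dmap[OF represents_kappa C_diff_linear[OF cont_linear_swap_mid]]
  show ?thesis
    using represents_compose[OF represents_compose[OF represents_compose[OF represents_kappa DS]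
        represents_kappa] Dk]
    by (simp add: clift_def clift_loc_def[abs_def] comp_assoc)
qed

lemma clift_loc_eq:
  assumes F: "spray_loc i F" and \<alpha>: "\<alpha> \<in> Idx M" and c: "vpair (vpair x y) (vpair z w) \<in> overlap M (Suc (Suc i)) \<alpha> \<alpha>"
  defines "K \<equiv> \<lambda>q. vsnd (vsnd (F \<alpha> q))"
  shows "has_dir_deriv K (vpair x z) (vpair y w) (dir_deriv K (vpair x z) (vpair y w))"
    and "clift_loc (F \<alpha>) (vpair (vpair x y) (vpair z w)) = vpair (vpair (vpair x y) (vpair z w))
      (vpair (vpair z w) (vpair (K (vpair x z)) (dir_deriv K (vpair x z) (vpair y w))))"
proof -
  have *: "vpair x z \<in> overlap M (Suc i) \<alpha> \<alpha>" "vpair y w \<in> model (Suc i)" using c by auto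
  have "C_diff 1 (model (Suc i)) (overlap M (Suc i) \<alpha> \<alpha>) (F \<alpha>)"
    and eq: "\<And>q. q \<in> overlap M (Suc i) \<alpha> \<alpha> \<Longrightarrow> F \<alpha> q = vpair q (vpair (vsnd q) (K q))"
    using F \<alpha> unfolding spray_loc_def K_def by blast+
  note F' = this(1)
  show "has_dir_deriv K (vpair x z) (vpair y w) (dir_deriv K (vpair x z) (vpair y w))"
    and "clift_loc (F \<alpha>) (vpair (vpair x y) (vpair z w)) = vpair (vpair (vpair x y) (vpair z w))
      (vpair (vpair z w) (vpair (K (vpair x z)) (dir_deriv K (vpair x z) (vpair y w))))"
    by (rule clift_loc_semispray[OF relopen_overlap[OF \<alpha> \<alpha>] F' _ *], erule eq)+
qed

text \<open>Class k of the lift uses class k + 1 of F. The new fibre variable is (z, w), so scaling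
  it scales z and w together while x and y stay fixed, which is the scaling in the differentiated
  homogeneity identity.\<close>

lemma spray_loc_clift:
  assumes F: "spray_loc i F"
  shows "spray_loc (Suc i) (\<lambda>\<alpha>. clift_loc (F \<alpha>))"
  unfolding spray_loc_def
proof (intro ballI conjI allI)
  fix \<alpha> k assume \<alpha>: "\<alpha> \<in> Idx M"
  let ?X = "model (Suc (Suc i))" and ?U = "overlap M (Suc (Suc i)) \<alpha> \<alpha>"
  have U: "relopen ?X ?U" using \<alpha> by (intro relopen_overlap)
  have "C_diff (Suc k) (model (Suc i)) (overlap M (Suc i) \<alpha> \<alpha>) (F \<alpha>)"
    using F \<alpha> unfolding spray_loc_def by blast
  then have TF: "C_diff k ?X ?U (Tmap (F \<alpha>))" by simp
  \<comment> \<open>The outer two maps are linear on the whole space, so composing with them imposes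
    no condition on images.\<close>
  have univ: "relopen UNIV (UNIV :: (nat \<Rightarrow> 'e) set)"
    by (auto simp: relopen_def closed_sub_def)
  have "swap_mid ` ?U \<subseteq> ?U"
    using representsD(1)[OF represents_kappa \<alpha>] by blast
  note C_diff_compose[OF U C_diff_linear[OF cont_linear_swap_mid] U TF this]
  from C_diff_compose[OF U this univ C_diff_linear[OF cont_linear_swap_mid]]
  have "C_diff k ?X ?U (\<lambda>c. swap_mid (Tmap (F \<alpha>) (swap_mid c)))" by simp
  from C_diff_compose[OF U this univ C_diff_linear[OF cont_linear_Tmap[OF cont_linear_swap_mid]]]
  show "C_diff k ?X ?U (clift_loc (F \<alpha>))" by (simp add: clift_loc_def[abs_def])
next
  fix \<alpha> c assume \<alpha>: "\<alpha> \<in> Idx M" and c: "c \<in> overlap M (Suc (Suc i)) \<alpha> \<alpha>"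
  obtain x y z w where "c = vpair (vpair x y) (vpair z w)" by (metis vpair_vfst_vsnd)
  with clift_loc_eq(2)[OF F \<alpha>, of x y z w] c
  show "clift_loc (F \<alpha>) c = vpair c (vpair (vsnd c) (vsnd (vsnd (clift_loc (F \<alpha>) c))))" by simp
next
  fix \<alpha> s and p q :: "nat \<Rightarrow> 'e" assume \<alpha>: "\<alpha> \<in> Idx M" and p: "p \<in> overlap M (Suc i) \<alpha> \<alpha>" and q: "q \<in> model (Suc i)"
  define K where "K = (\<lambda>q. vsnd (vsnd (F \<alpha> q)))"
  have hom: "K (vpair x (s *\<^sub>R z)) = s\<^sup>2 *\<^sub>R K (vpair x z)" if "x \<in> overlap M i \<alpha> \<alpha>" "z \<in> model i" for x z
    using F \<alpha> that unfolding spray_loc_def K_def by blast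
  obtain x y where p': "p = vpair x y" by (metis vpair_vfst_vsnd)
  obtain z w where q': "q = vpair z w" by (metis vpair_vfst_vsnd)
  have *: "x \<in> overlap M i \<alpha> \<alpha>" "z \<in> model i" "y \<in> model i" "w \<in> model i"
    using p q by (auto simp: p' q')
  then have s: "s *\<^sub>R z \<in> model i" "s *\<^sub>R w \<in> model i"
    using closed_subD(3)[OF closed_sub_model] by auto
  note 1 = clift_loc_eq[OF F \<alpha>, of x y z w, folded K_def]
  note 2 = clift_loc_eq[OF F \<alpha>, of x y "s *\<^sub>R z" "s *\<^sub>R w", folded K_def]
  have "dir_deriv K (vpair x (s *\<^sub>R z)) (vpair y (s *\<^sub>R w)) = s\<^sup>2 *\<^sub>R dir_deriv K (vpair x z) (vpair y w)"
    by (intro dir_deriv_eqI dir_deriv_homogeneous[OF relopen_overlap[OF \<alpha> \<alpha>] hom _ *(1)])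
      (use 1(1) * in auto)
  with 1(2) 2(2) * s hom[OF *(1,2)]
  show "vsnd (vsnd (clift_loc (F \<alpha>) (vpair p (s *\<^sub>R q)))) = s\<^sup>2 *\<^sub>R vsnd (vsnd (clift_loc (F \<alpha>) (vpair p q)))"
    by (simp add: p' q' vpair_scaleR K_def)
qed

lemma spray_clift:
  assumes "spray M i S"
  shows "spray M (Suc i) (clift M (Suc i) S)"
proof -
  note S = spray_imp_spray_loc[OF assms]
  show ?thesis by (rule spray_loc_imp_spray[OF represents_clift[OF S] spray_loc_clift[OF S(2)]])
qed

end

section \<open>Projective limits\<close>

lemma lcomp_simps [simp]:
  "lcomp (c + d) i = lcomp c i + lcomp d i" "lcomp (c - d) i = lcomp c i - lcomp d i"
  "lcomp (r *\<^sub>R c) i = r *\<^sub>R lcomp c i" "lcomp (- c) i = - lcomp c i"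
  by (auto simp: lcomp_def fun_eq_iff)

lemma lcomp_zero [simp]: "lcomp 0 i = 0"
  by (simp add: lcomp_def fun_eq_iff)

lemma lcomp_vpair [simp]: "lcomp (vpair c d) i = vpair (lcomp c i) (lcomp d i)"
  by (auto simp: lcomp_def vpair_def fun_eq_iff)

lemma lcomp_vfst [simp]: "lcomp (vfst c) i = vfst (lcomp c i)"
  and lcomp_vsnd [simp]: "lcomp (vsnd c) i = vsnd (lcomp c i)"
  by (auto simp: lcomp_def vfst_def vsnd_def)

lemma lcomp_lim: "lcomp (\<lambda>j i. f i j) i = f i"
  by (simp add: lcomp_def)

lemma lcomp_eqI: "(\<And>i. lcomp c i = lcomp d i) \<Longrightarrow> c = d"
  by (auto simp: lcomp_def fun_eq_iff)

lemma tendsto_lcomp_iff: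
  fixes f :: "'c \<Rightarrow> nat \<Rightarrow> nat \<Rightarrow> 'b::topological_space"
  shows "(f \<longlongrightarrow> l) F \<longleftrightarrow> (\<forall>i. ((\<lambda>x. lcomp (f x) i) \<longlongrightarrow> lcomp l i) F)"
  by (auto simp: tendsto_coordinatewise lcomp_def)

lemma continuous_on_lcomp:
  fixes S :: "(nat \<Rightarrow> nat \<Rightarrow> 'b::topological_space) set"
  shows "continuous_on S (\<lambda>c. lcomp c i)"
  unfolding continuous_on_def
  by (intro ballI tendsto_lcomp_iff[THEN iffD1, rule_format, OF tendsto_ident_at])

text \<open>
  In the limit space, stability of a domain under small motions along lines replaces relative
  openness: it suffices for directional derivatives, and it passes to tangent bundles trivially.
\<close>

definition line_open :: "'a::real_vector set \<Rightarrow> 'a set \<Rightarrow> bool" where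
  "line_open X U \<longleftrightarrow> subspace X \<and> (\<forall>x\<in>U. \<forall>v\<in>X. \<forall>\<^sub>F t in at (0::real). x + t *\<^sub>R v \<in> U)"

lemma line_open_Tset:
  assumes "line_open X U"
  shows "line_open (Tset X X) (Tset X U)"
proof -
  have X: "subspace X" using assms by (simp add: line_open_def)
  have "\<forall>\<^sub>F t in at (0::real). c + t *\<^sub>R d \<in> Tset X U"
    if "c \<in> Tset X U" "d \<in> Tset X X" for c d
  proof -
    have "\<forall>\<^sub>F t in at (0::real). vfst c + t *\<^sub>R vfst d \<in> U"
      using assms that by (auto simp: line_open_def Tset_iff)
    then show ?thesis
      by eventually_elim (use that X in \<open>auto simp: Tset_iff subspace_add subspace_scale\<close>)
  qed
  moreover have "subspace (Tset X X)"
    using X by (auto simp: subspace_def Tset_iff)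
  ultimately show ?thesis by (auto simp: line_open_def)
qed

text \<open>Component i of g depends only on component i of the argument, so the derivative is the
  sequence of derivatives and \<open>Tmap\<close> commutes with \<open>lcomp\<close>. The induction
  treats all levels together.\<close>

lemma C_diff_lim:
  fixes f :: "nat \<Rightarrow> (nat \<Rightarrow> 'a::real_normed_vector) \<Rightarrow> nat \<Rightarrow> 'b::real_normed_vector"
    and X' U' :: "(nat \<Rightarrow> nat \<Rightarrow> 'a) set"
  assumes "\<And>i. C_diff k (X i) (U i) (f i)"
    and "line_open X' U'" "\<And>c i. c \<in> X' \<Longrightarrow> lcomp c i \<in> X i" "\<And>c i. c \<in> U' \<Longrightarrow> lcomp c i \<in> U i"
    and "\<And>c i. c \<in> U' \<Longrightarrow> lcomp (g c) i = f i (lcomp c i)"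
  shows "C_diff k X' U' g"
  using assms
proof (induction k arbitrary: X U f X' U' g)
  case 0
  have "continuous_on U' (\<lambda>c. lcomp (g c) i)" for i
  proof -
    have "continuous_on U' (\<lambda>c. f i (lcomp c i))"
      using 0(1)[of i] 0(4) by (auto intro!: continuous_on_compose2[OF _ continuous_on_lcomp])
    then show ?thesis using 0(5) by (simp cong: continuous_on_cong)
  qed
  then have "continuous_on U' g"
    unfolding continuous_on_def by (subst tendsto_lcomp_iff) blast
  then show ?case by simp
next
  case (Suc k)
  \<comment> \<open>The levelwise derivatives are stored with transposed arguments, as limit vectors
    are.\<close>
  have d: "has_dir_deriv g x v (\<lambda>j i. dir_deriv (f i) (lcomp x i) (lcomp v i) j)"
    if x: "x \<in> U'" and v: "v \<in> X'" for x v
    unfolding has_dir_deriv_def tendsto_lcomp_iff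
  proof
    fix i
    have "has_dir_deriv (f i) (lcomp x i) (lcomp v i) (dir_deriv (f i) (lcomp x i) (lcomp v i))"
      using Suc.prems(1) by (rule C_diff_has_dir_deriv) (use Suc.prems x v in auto)
    then have "((\<lambda>t. (f i (lcomp x i + t *\<^sub>R lcomp v i) - f i (lcomp x i)) /\<^sub>R t) \<longlongrightarrow>
        dir_deriv (f i) (lcomp x i) (lcomp v i)) (at 0)"
      by (simp add: has_dir_deriv_def)
    moreover have "\<forall>\<^sub>F t in at 0. (f i (lcomp x i + t *\<^sub>R lcomp v i) - f i (lcomp x i)) /\<^sub>R t =
        lcomp ((g (x + t *\<^sub>R v) - g x) /\<^sub>R t) i"
    proof -
      have "\<forall>\<^sub>F t in at (0::real). x + t *\<^sub>R v \<in> U'"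
        using Suc.prems(2) x v by (auto simp: line_open_def)
      then show ?thesis
      proof eventually_elim
        case (elim t)
        have "lcomp (g (x + t *\<^sub>R v)) i = f i (lcomp x i + t *\<^sub>R lcomp v i)"
          using Suc.prems(5)[OF elim, of i] by (simp only: lcomp_simps)
        then show ?case using Suc.prems(5)[OF x, of i] by (simp only: lcomp_simps)
      qed
    qed
    ultimately show "((\<lambda>t. lcomp ((g (x + t *\<^sub>R v) - g x) /\<^sub>R t) i) \<longlongrightarrow>
        lcomp (\<lambda>j i. dir_deriv (f i) (lcomp x i) (lcomp v i) j) i) (at 0)"
      unfolding lcomp_lim[of "\<lambda>i. dir_deriv (f i) (lcomp x i) (lcomp v i)"]
      by (rule Lim_transform_eventually)
  qed
  have "C_diff k (Tset X' X') (Tset X' U') (Tmap g)"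
  proof (rule Suc.IH)
    show "C_diff k (Tset (X i) (X i)) (Tset (X i) (U i)) (Tmap (f i))" for i
      using Suc.prems(1)[of i] by simp
    show "line_open (Tset X' X') (Tset X' U')" using Suc.prems(2) by (rule line_open_Tset)
    show "lcomp c i \<in> Tset (X i) (X i)" if "c \<in> Tset X' X'" for c i
      using that Suc.prems(3)[of "vfst c" i] Suc.prems(3)[of "vsnd c" i] by (simp add: Tset_iff)
    show "lcomp c i \<in> Tset (X i) (U i)" if "c \<in> Tset X' U'" for c i
      using that Suc.prems(4)[of "vfst c" i] Suc.prems(3)[of "vsnd c" i] by (simp add: Tset_iff)
    show "lcomp (Tmap g c) i = Tmap (f i) (lcomp c i)" if "c \<in> Tset X' U'" for c i
      using that Suc.prems(5)[of "vfst c" i] dir_deriv_eqI[OF d[of "vfst c" "vsnd c"]]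
      by (simp add: Tset_iff Tmap_def lcomp_lim[of "\<lambda>i. dir_deriv (f i) (vfst (lcomp c i)) (vsnd (lcomp c i))"])
  qed
  with d show ?case by auto
qed

lemma model_infD:
  assumes "c \<in> model_inf"
  shows "lcomp c i \<in> model i" "vfst (lcomp c (Suc i)) = lcomp c i"
  using assms by (auto simp: model_inf_def)

lemma subspace_model_inf: "subspace (model_inf :: (nat \<Rightarrow> nat \<Rightarrow> 'e::banach) set)"
  by (auto simp: subspace_def model_inf_def closed_subD[OF closed_sub_model])

context banach_atlas
begin

text \<open>Higher overlaps constrain only the base point, and coherence transports that constraint
  from level 0.\<close>

lemma dom_inf_iff:
  assumes "c \<in> model_inf"
  shows "c \<in> dom_inf M \<alpha> \<longleftrightarrow> lcomp c 0 \<in> overlap M 0 \<alpha> \<alpha>"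
proof -
  have "lcomp c i \<in> overlap M i \<alpha> \<alpha>" if "lcomp c 0 \<in> overlap M 0 \<alpha> \<alpha>" for i
  proof (induction i)
    case (Suc i)
    then show ?case
      using model_infD[OF assms, of i] model_infD(1)[OF assms, of "Suc i"] by (simp add: Tset_iff)
  qed (rule that)
  then show ?thesis unfolding dom_inf_def using assms by blast
qed

text \<open>Only level 0 decides membership, so one bound on t serves all levels; no infinite
  intersection of neighbourhoods arises.\<close>

lemma line_open_dom_inf:
  assumes "\<alpha> \<in> Idx M"
  shows "line_open model_inf (dom_inf M \<alpha>)"
  unfolding line_open_def
proof (intro conjI ballI)
  fix x v assume x: "x \<in> dom_inf M \<alpha>" and v: "v \<in> (model_inf :: (nat \<Rightarrow> nat \<Rightarrow> 'e) set)"
  have x': "x \<in> model_inf" using x by (simp add: dom_inf_def)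
  have "\<forall>\<^sub>F t in at 0. lcomp x 0 + t *\<^sub>R lcomp v 0 \<in> overlap M 0 \<alpha> \<alpha>"
    using relopen_overlap[OF assms assms] _ model_infD(1)[OF v]
    by (rule eventually_line) (use x in \<open>unfold dom_inf_def, blast\<close>)
  then show "\<forall>\<^sub>F t in at (0::real). x + t *\<^sub>R v \<in> dom_inf M \<alpha>"
  proof eventually_elim
    case (elim t)
    have "x + t *\<^sub>R v \<in> model_inf"
      by (rule subspace_add[OF subspace_model_inf x' subspace_scale[OF subspace_model_inf v]])
    from dom_inf_iff[OF this] elim show ?case by simp
  qed
qed (rule subspace_model_inf)

text \<open>The first map serves twice: as a connecting map of the tangent bundle of the limit, and
  as level i of the tangent map of its projection.\<close>

lemma represents_Dproj:
  "represents (Suc i + 1) (Suc i) (Dproj M 1 i) (\<lambda>_. Tmap vfst)"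
  "represents (Suc i + 2) (Suc i + 1) (Dproj M 2 i) (\<lambda>_. Tmap (Tmap vfst))"
proof -
  have 1: "represents (Suc (Suc i)) (Suc i) (Dmap M (Suc i) proj) (\<lambda>_. Tmap vfst)"
    by (rule represents_Dmap[OF represents_proj C_diff_linear[OF cont_linear_vfst]])
  then show "represents (Suc i + 1) (Suc i) (Dproj M 1 i) (\<lambda>_. Tmap vfst)" by simp
  show "represents (Suc i + 2) (Suc i + 1) (Dproj M 2 i) (\<lambda>_. Tmap (Tmap vfst))"
    using represents_Dmap[OF 1 C_diff_linear[OF cont_linear_Tmap[OF cont_linear_vfst]]]
    by (simp add: numeral_2_eq_2)
qed

lemma Tmap_vfst: "Tmap vfst (c :: nat \<Rightarrow> 'e) = vpair (vfst (vfst c)) (vfst (vsnd c))"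
  by (rule Tmap_linear[OF cont_linear_vfst])

lemma Tmap_Tmap_vfst: "Tmap (Tmap vfst) (c :: nat \<Rightarrow> 'e) = vpair (Tmap vfst (vfst c)) (Tmap vfst (vsnd c))"
  by (rule Tmap_linear[OF cont_linear_Tmap[OF cont_linear_vfst]])

section \<open>The limit of the iterated lifts\<close>

context
  fixes S :: "('i, 'e) tpoint \<Rightarrow> ('i, 'e) tpoint"
  assumes S: "spray M 0 S"
begin

definition lift_rep :: "nat \<Rightarrow> 'i \<Rightarrow> (nat \<Rightarrow> 'e) \<Rightarrow> nat \<Rightarrow> 'e" where
  "lift_rep j \<alpha> = loc_rep M (Suc j) (clift_iter M S j) \<alpha> \<alpha>"

lemma spray_clift_iter: "spray M j (clift_iter M S j)"
  by (induction j) (simp_all add: S spray_clift)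

lemma represents_clift_iter: "represents (Suc j) (Suc (Suc j)) (clift_iter M S j) (lift_rep j)"
  unfolding lift_rep_def[abs_def] by (rule spray_imp_spray_loc[OF spray_clift_iter])

lemma spray_loc_lift_rep: "spray_loc j (lift_rep j)"
  unfolding lift_rep_def[abs_def] by (rule spray_imp_spray_loc[OF spray_clift_iter])

lemma lift_rep_semispray:
  assumes "\<alpha> \<in> Idx M" "c \<in> overlap M (Suc j) \<alpha> \<alpha>"
  shows "vfst (lift_rep j \<alpha> c) = c" "vfst (vsnd (lift_rep j \<alpha> c)) = vsnd c"
proof -
  have "lift_rep j \<alpha> c = vpair c (vpair (vsnd c) (vsnd (vsnd (lift_rep j \<alpha> c))))"
    using spray_loc_lift_rep[of j] assms unfolding spray_loc_def by blast
  then show "vfst (lift_rep j \<alpha> c) = c" "vfst (vsnd (lift_rep j \<alpha> c)) = vsnd c"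
    by (metis vfst_vpair, metis vfst_vpair vsnd_vpair)
qed

text \<open>The compatibility of consecutive lifts in a chart, by which the levelwise lifts send
  coherent sequences to coherent sequences.\<close>

lemma lift_rep_Suc:
  assumes "\<alpha> \<in> Idx M" "c \<in> overlap M (Suc (Suc j)) \<alpha> \<alpha>"
  shows "Tmap (Tmap vfst) (lift_rep (Suc j) \<alpha> c) = lift_rep j \<alpha> (Tmap vfst c)"
proof -
  obtain x y z w where c: "c = vpair (vpair x y) (vpair z w)" by (metis vpair_vfst_vsnd)
  have 1: "lift_rep (Suc j) \<alpha> c = clift_loc (lift_rep j \<alpha>) c"
    using represents_unique[OF _ represents_clift[OF represents_clift_iter spray_loc_lift_rep] assms]
      represents_clift_iter[of "Suc j"] by simp
  have xz: "vpair x z \<in> overlap M (Suc j) \<alpha> \<alpha>" using assms(2) by (auto simp: c)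
  have "lift_rep j \<alpha> (vpair x z) = vpair (vpair x z) (vpair z (vsnd (vsnd (lift_rep j \<alpha> (vpair x z)))))"
    using lift_rep_semispray[OF assms(1) xz] by (metis vpair_vfst_vsnd vsnd_vpair)
  moreover have "Tmap (Tmap vfst) (clift_loc (lift_rep j \<alpha>) c) =
      vpair (vpair x z) (vpair z (vsnd (vsnd (lift_rep j \<alpha> (vpair x z)))))"
    using clift_loc_eq(2)[OF spray_loc_lift_rep assms(1), of x y z w] assms(2)
    by (simp add: c Tmap_Tmap_vfst Tmap_vfst)
  ultimately show ?thesis unfolding 1 by (simp add: c Tmap_vfst)
qed

text \<open>The chart may depend on i: coherence relates only neighbouring levels, so a chart common
  to two of them is enough.\<close>

lemma TMinf_1_chart:
  assumes "\<xi> \<in> TMinf M 1"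
  obtains \<alpha> c where "\<alpha> \<in> Idx M" "c \<in> overlap M (Suc (Suc i)) \<alpha> \<alpha>"
    "\<xi> (Suc i) = tpt M (Suc (Suc i)) \<alpha> c" "\<xi> i = tpt M (Suc i) \<alpha> (Tmap vfst c)"
    "Tmap vfst c \<in> overlap M (Suc i) \<alpha> \<alpha>"
proof -
  have "\<xi> (Suc i) \<in> TM M (Suc (Suc i))" "Dproj M 1 i (\<xi> (Suc i)) = \<xi> i"
    using assms by (auto simp: TMinf_def)
  with representsD(1,2)[OF represents_Dproj(1)] show ?thesis
    by (elim TM_E) (use that in auto)
qed

lemma vector_field_inf_clift: "vector_field_inf M (clift_inf M S)"
  unfolding vector_field_inf_def smooth_def
proof (intro conjI ballI allI)
  fix \<xi> assume \<xi>: "\<xi> \<in> TMinf M 1"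
  have V: "vector_field M (Suc i) (clift_iter M S i)" for i
    using spray_clift_iter[of i] by (simp add: spray_def semispray_def)
  have \<xi>': "\<xi> i \<in> TM M (Suc i)" for i using \<xi> by (auto simp: TMinf_def)
  show "(\<lambda>i. proj (clift_inf M S \<xi> i)) = \<xi>"
    using V \<xi>' by (auto simp: clift_inf_def vector_field_def)
  have "Dproj M 2 i (clift_inf M S \<xi> (Suc i)) = clift_inf M S \<xi> i" for i
  proof -
    obtain \<alpha> c where \<alpha>: "\<alpha> \<in> Idx M" and c: "c \<in> overlap M (Suc (Suc i)) \<alpha> \<alpha>"
      and *: "\<xi> (Suc i) = tpt M (Suc (Suc i)) \<alpha> c" "\<xi> i = tpt M (Suc i) \<alpha> (Tmap vfst c)"
        "Tmap vfst c \<in> overlap M (Suc i) \<alpha> \<alpha>"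
      using \<xi> by (rule TMinf_1_chart)
    note F' = representsD[OF represents_clift_iter \<alpha> c]
    have "Dproj M 2 i (clift_inf M S \<xi> (Suc i)) = tpt M (Suc (Suc i)) \<alpha> (Tmap (Tmap vfst) (lift_rep (Suc i) \<alpha> c))"
      using representsD(2)[OF represents_Dproj(2) \<alpha>, of "lift_rep (Suc i) \<alpha> c" i] F'(1,2)
      by (simp add: clift_inf_def *(1) numeral_2_eq_2)
    also have "\<dots> = clift_inf M S \<xi> i"
      using representsD(2)[OF represents_clift_iter \<alpha> *(3)] lift_rep_Suc[OF \<alpha> c]
      by (simp add: clift_inf_def *(2))
    finally show ?thesis .
  qed
  moreover have "clift_inf M S \<xi> i \<in> TM M (i + 2)" for i
    using V \<xi>' by (auto simp: clift_inf_def vector_field_def numeral_2_eq_2)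
  ultimately show "clift_inf M S \<xi> \<in> TMinf M 2" by (simp add: TMinf_def)
next
  fix \<alpha> k assume \<alpha>: "\<alpha> \<in> Idx M"
  show "C_diff k (Tset model_inf model_inf) (Tset model_inf (dom_inf M \<alpha>)) (loc_rep_inf M (clift_inf M S) \<alpha>)"
  proof (rule C_diff_lim)
    show "C_diff k (model (Suc i)) (overlap M (Suc i) \<alpha> \<alpha>) (lift_rep i \<alpha>)" for i
      using spray_loc_lift_rep[of i] \<alpha> unfolding spray_loc_def by blast
    show "line_open (Tset model_inf model_inf) (Tset model_inf (dom_inf M \<alpha>))"
      using line_open_dom_inf[OF \<alpha>] by (rule line_open_Tset)
    show "lcomp c i \<in> model (Suc i)" if "c \<in> Tset model_inf model_inf" for c i
      using that model_infD(1)[of "vfst c" i] model_infD(1)[of "vsnd c" i] by (simp add: Tset_iff)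
    show "lcomp c i \<in> overlap M (Suc i) \<alpha> \<alpha>" if "c \<in> Tset model_inf (dom_inf M \<alpha>)" for c i
      using that model_infD(1)[of "vsnd c" i] by (simp add: Tset_iff dom_inf_def)
    \<comment> \<open>Both sides are the same coordinate of the same point, by unfolding
      alone.\<close>
    show "lcomp (loc_rep_inf M (clift_inf M S) \<alpha> c) i = lift_rep i \<alpha> (lcomp c i)" for c i
      by (simp add: lcomp_def loc_rep_inf_def lift_rep_def loc_rep_def clift_inf_def)
  qed
qed

text \<open>The tangent map of the projection keeps the first component of each half of (x, z; z,
  K), that is (x, z), which is the argument. Homogeneity is inherited at each level because
  \<open>lcomp\<close> commutes with scaling.\<close>

lemma spray_inf_clift: "spray_inf M (clift_inf M S)"
  unfolding spray_inf_def semispray_inf_def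
proof (intro conjI ballI allI)
  show "vector_field_inf M (clift_inf M S)" by (rule vector_field_inf_clift)
next
  fix \<xi> assume \<xi>: "\<xi> \<in> TMinf M 1"
  show "Dpi_inf M (clift_inf M S \<xi>) = \<xi>"
  proof
    fix i
    have "\<xi> i \<in> TM M (Suc i)" using \<xi> by (auto simp: TMinf_def)
    then obtain \<alpha> c where \<alpha>: "\<alpha> \<in> Idx M" and c: "c \<in> overlap M (Suc i) \<alpha> \<alpha>"
      and *: "\<xi> i = tpt M (Suc i) \<alpha> c" by (rule TM_E)
    note F' = representsD[OF represents_clift_iter \<alpha> c]
    have "Dpi_inf M (clift_inf M S \<xi>) i = tpt M (Suc i) \<alpha> (Tmap vfst (lift_rep i \<alpha> c))"
      using representsD(2)[OF represents_Dproj(1) \<alpha>, of "lift_rep i \<alpha> c" i] F'(1,2)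
      by (simp add: Dpi_inf_def clift_inf_def *)
    also have "Tmap vfst (lift_rep i \<alpha> c) = c"
      using lift_rep_semispray[OF \<alpha> c] by (simp add: Tmap_vfst)
    finally show "Dpi_inf M (clift_inf M S \<xi>) i = \<xi> i" using * by simp
  qed
next
  fix \<alpha> and s :: real and x y
  assume \<alpha>: "\<alpha> \<in> Idx M" and x: "x \<in> dom_inf M \<alpha>" and y: "y \<in> (model_inf :: (nat \<Rightarrow> nat \<Rightarrow> 'e) set)"
  have L': "lcomp (loc_rep_inf M (clift_inf M S) \<alpha> c) i = loc_rep M (Suc i) (clift_iter M S i) \<alpha> \<alpha> (lcomp c i)"
    for c i by (simp add: lcomp_def loc_rep_inf_def loc_rep_def clift_inf_def)
  have L: "lcomp (spray_coeff_inf M (clift_inf M S) \<alpha> x z) i =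
      spray_coeff M i (clift_iter M S i) \<alpha> (lcomp x i) (lcomp z i)" for z i
    by (simp add: spray_coeff_inf_def spray_coeff_def L')
  show "spray_coeff_inf M (clift_inf M S) \<alpha> x (s *\<^sub>R y) = s\<^sup>2 *\<^sub>R spray_coeff_inf M (clift_inf M S) \<alpha> x y"
  proof (rule lcomp_eqI)
    fix i
    have "lcomp x i \<in> overlap M i \<alpha> \<alpha>" "lcomp y i \<in> model i"
      using x model_infD(1)[OF y] by (auto simp: dom_inf_def)
    then show "lcomp (spray_coeff_inf M (clift_inf M S) \<alpha> x (s *\<^sub>R y)) i =
        lcomp (s\<^sup>2 *\<^sub>R spray_coeff_inf M (clift_inf M S) \<alpha> x y) i"
      using spray_clift_iter[of i] \<alpha> by (simp add: L spray_def)
  qed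
qed

end

end

theorem proposition3p13:
  fixes M :: "('m, 'i, 'e::banach) atlas"
  assumes "banach_manifold M" and "partitionable M"
  shows "(\<forall>i S. spray M i S \<longrightarrow> spray M (Suc i) (clift M (Suc i) S)) \<and>
         (\<forall>S. spray M 0 S \<longrightarrow> spray_inf M (clift_inf M S))"
proof -
  interpret banach_atlas M using assms(1) by unfold_locales
  show ?thesis using spray_clift spray_inf_clift by blast
qed

end
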